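(* Let $A$ be a commutative ring with unity. For any ideal $\mathfrak{a}$ of $A$, we have the equalities $$\mathrm{C}(A)_{\mathfrak{a}\text{-tor}}\cap \mathrm{C}(A)_{\mathfrak{a}\text{-red}}= \mathrm{C}(A)_{\mathfrak{a}\text{-com}}\cap \mathrm{C}(A)_{\mathfrak{a}\text{-cor}}=\{M\in\mathrm{C}(A): \mathfrak{a}M\cong 0\}.$$
   Context: $\mathrm{C}(A)$ is the category of chain complexes $M=(M^n,d_M^n)_{n\in\mathbb{Z}}$ of $A$-modules. For $A$-modules, $\Gamma_{\mathfrak{a}}(-)=\varinjlim_k \mathrm{Hom}_A(A/\mathfrak{a}^k,-)$ and $\Lambda_{\mathfrak{a}}(-)=\varprojlim_k (A/\mathfrak{a}^k\otimes_A -)$. An $A$-module $M$ is $\mathfrak{a}$-torsion if $\Gamma_{\mathfrak{a}}(M)\cong M$, $\mathfrak{a}$-adically complete if $M\cong\Lambda_{\mathfrak{a}}(M)$, $\mathfrak{a}$-reduced if for all $m\in M$, $\mathfrak{a}^2m=0$ implies $\mathfrak{a}m=0$, and $\mathfrak{a}$-coreduced if $\mathfrak{a}M=\mathfrak{a}^2M$. A complex is $\mathfrak{a}$-torsion (resp. $\mathfrak{a}$-adically complete, $\mathfrak{a}$-reduced, $\mathfrak{a}$-coreduced) if each of its modules is. The full subcategories of $\mathrm{C}(A)$ consisting of these complexes are denoted $\mathrm{C}(A)_{\mathfrak{a}\text{-tor}}$, $\mathrm{C}(A)_{\mathfrak{a}\text{-com}}$, $\mathrm{C}(A)_{\mathfrak{a}\text{-red}}$,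 $\mathrm{C}(A)_{\mathfrak{a}\text{-cor}}$ respectively. *)

theory Defs
  imports "HOL-Algebra.Module" "HOL-Algebra.Ideal_Product"
begin

text \<open>
  Library modules are records extending rings; their multiplication and unit are not part of the
  module structure (the locale \<^locale>\<open>module\<close> does not mention them), so they are left
  unspecified here.
\<close>

definition mk_module ::
  "'m set \<Rightarrow> 'm \<Rightarrow> ('m \<Rightarrow> 'm \<Rightarrow> 'm) \<Rightarrow> ('a \<Rightarrow> 'm \<Rightarrow> 'm) \<Rightarrow> ('a, 'm) module"
  where "mk_module S z pl sm =
    \<lparr>carrier = S, mult = undefined, one = undefined, zero = z, add = pl, smult = sm\<rparr>"


section \<open>Homomorphisms, submodules, quotients\<close>

text \<open>Homomorphisms are extensional functions, so that equality of homomorphisms is equality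
  in HOL.\<close>

definition mod_hom ::
  "('a, 'r) ring_scheme \<Rightarrow> ('a, 'm, 'x) module_scheme \<Rightarrow> ('a, 'n, 'y) module_scheme \<Rightarrow> ('m \<Rightarrow> 'n) set"
  where "mod_hom R M N =
    {f \<in> carrier M \<rightarrow>\<^sub>E carrier N.
       (\<forall>x\<in>carrier M. \<forall>y\<in>carrier M. f (x \<oplus>\<^bsub>M\<^esub> y) = f x \<oplus>\<^bsub>N\<^esub> f y) \<and>
       (\<forall>r\<in>carrier R. \<forall>x\<in>carrier M. f (r \<odot>\<^bsub>M\<^esub> x) = r \<odot>\<^bsub>N\<^esub> f x)}"

definition mod_iso ::
  "('a, 'r) ring_scheme \<Rightarrow> ('a, 'm, 'x) module_scheme \<Rightarrow> ('a, 'n, 'y) module_scheme \<Rightarrow> bool"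
  where "mod_iso R M N \<longleftrightarrow> (\<exists>f\<in>mod_hom R M N. bij_betw f (carrier M) (carrier N))"

definition Hom_module ::
  "('a, 'r) ring_scheme \<Rightarrow> ('a, 'm, 'x) module_scheme \<Rightarrow> ('a, 'n, 'y) module_scheme
    \<Rightarrow> ('a, 'm \<Rightarrow> 'n) module"
  where "Hom_module R M N =
    mk_module (mod_hom R M N)
      (\<lambda>x\<in>carrier M. \<zero>\<^bsub>N\<^esub>)
      (\<lambda>f g. \<lambda>x\<in>carrier M. f x \<oplus>\<^bsub>N\<^esub> g x)
      (\<lambda>r f. \<lambda>x\<in>carrier M. r \<odot>\<^bsub>N\<^esub> f x)"

definition submodule_span ::
  "('a, 'r) ring_scheme \<Rightarrow> ('a, 'm, 'x) module_scheme \<Rightarrow> 'm set \<Rightarrow> 'm set"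
  where "submodule_span R M S = \<Inter>{H. submodule H R M \<and> S \<subseteq> H}"

text \<open>The union over representatives in the scalar multiplication is a union of equal cosets.\<close>

definition quot_module ::
  "('a, 'm, 'x) module_scheme \<Rightarrow> 'm set \<Rightarrow> ('a, 'm set) module"
  where "quot_module M K =
    mk_module (a_rcosets\<^bsub>M\<^esub> K) K (set_add M) (\<lambda>r X. \<Union>x\<in>X. K +>\<^bsub>M\<^esub> (r \<odot>\<^bsub>M\<^esub> x))"

definition regular_module :: "('a, 'r) ring_scheme \<Rightarrow> ('a, 'a) module"
  where "regular_module R = mk_module (carrier R) \<zero>\<^bsub>R\<^esub> (add R) (mult R)"


section \<open>Tensor products\<close>

definition free_module :: "('a, 'r) ring_scheme \<Rightarrow> 'p set \<Rightarrow> ('a, 'p \<Rightarrow> 'a) module"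
  where "free_module R S =
    mk_module
      {u. range u \<subseteq> carrier R \<and> finite {p. u p \<noteq> \<zero>\<^bsub>R\<^esub>} \<and> {p. u p \<noteq> \<zero>\<^bsub>R\<^esub>} \<subseteq> S}
      (\<lambda>p. \<zero>\<^bsub>R\<^esub>)
      (\<lambda>u v p. u p \<oplus>\<^bsub>R\<^esub> v p)
      (\<lambda>r u p. r \<otimes>\<^bsub>R\<^esub> u p)"

definition free_gen :: "('a, 'r) ring_scheme \<Rightarrow> 'p \<Rightarrow> 'p \<Rightarrow> 'a"
  where "free_gen R p = (\<lambda>q. if q = p then \<one>\<^bsub>R\<^esub> else \<zero>\<^bsub>R\<^esub>)"

definition tensor_rels ::
  "('a, 'r) ring_scheme \<Rightarrow> ('a, 'm, 'x) module_scheme \<Rightarrow> ('a, 'n, 'y) module_scheme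
    \<Rightarrow> ('m \<times> 'n \<Rightarrow> 'a) set"
  where "tensor_rels R M N =
    (let F = free_module R (carrier M \<times> carrier N); e = free_gen R in
      {e (x \<oplus>\<^bsub>M\<^esub> x', y) \<ominus>\<^bsub>F\<^esub> (e (x, y) \<oplus>\<^bsub>F\<^esub> e (x', y)) | x x' y.
          x \<in> carrier M \<and> x' \<in> carrier M \<and> y \<in> carrier N} \<union>
      {e (x, y \<oplus>\<^bsub>N\<^esub> y') \<ominus>\<^bsub>F\<^esub> (e (x, y) \<oplus>\<^bsub>F\<^esub> e (x, y')) | x y y'.
          x \<in> carrier M \<and> y \<in> carrier N \<and> y' \<in> carrier N} \<union>
      {e (r \<odot>\<^bsub>M\<^esub> x, y) \<ominus>\<^bsub>F\<^esub> (r \<odot>\<^bsub>F\<^esub> e (x, y)) | r x y.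
          r \<in> carrier R \<and> x \<in> carrier M \<and> y \<in> carrier N} \<union>
      {e (x, r \<odot>\<^bsub>N\<^esub> y) \<ominus>\<^bsub>F\<^esub> (r \<odot>\<^bsub>F\<^esub> e (x, y)) | r x y.
          r \<in> carrier R \<and> x \<in> carrier M \<and> y \<in> carrier N})"

definition tensor_ker ::
  "('a, 'r) ring_scheme \<Rightarrow> ('a, 'm, 'x) module_scheme \<Rightarrow> ('a, 'n, 'y) module_scheme
    \<Rightarrow> ('m \<times> 'n \<Rightarrow> 'a) set"
  where "tensor_ker R M N =
    submodule_span R (free_module R (carrier M \<times> carrier N)) (tensor_rels R M N)"

definition tensor_module ::
  "('a, 'r) ring_scheme \<Rightarrow> ('a, 'm, 'x) module_scheme \<Rightarrow> ('a, 'n, 'y) module_scheme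
    \<Rightarrow> ('a, ('m \<times> 'n \<Rightarrow> 'a) set) module"
  where "tensor_module R M N =
    quot_module (free_module R (carrier M \<times> carrier N)) (tensor_ker R M N)"

text \<open>
  The map $f \otimes g \colon M \otimes N \to M' \otimes N'$, for homomorphisms $f \colon M \to M'$
  and $g \colon N \to N'$: the class of $\sum_p u_p (x_p, y_p)$ goes to the class of
  $\sum_p u_p (f x_p, g y_p)$. The union over representatives $u$ is again one of equal cosets.
\<close>

definition tensor_map ::
  "('a, 'r) ring_scheme \<Rightarrow> ('a, 'm, 'x) module_scheme \<Rightarrow> ('a, 'n, 'y) module_scheme
    \<Rightarrow> ('a, 'm2, 'x2) module_scheme \<Rightarrow> ('a, 'n2, 'y2) module_scheme
    \<Rightarrow> ('m \<Rightarrow> 'm2) \<Rightarrow> ('n \<Rightarrow> 'n2) \<Rightarrow> ('m \<times> 'n \<Rightarrow> 'a) set \<Rightarrow> ('m2 \<times> 'n2 \<Rightarrow> 'a) set"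
  where "tensor_map R M N M' N' f g =
    (let F' = free_module R (carrier M' \<times> carrier N') in
      (\<lambda>X\<in>carrier (tensor_module R M N). \<Union>u\<in>X.
         tensor_ker R M' N' +>\<^bsub>F'\<^esub>
           (\<Oplus>\<^bsub>F'\<^esub>p\<in>{p. u p \<noteq> \<zero>\<^bsub>R\<^esub>}. u p \<odot>\<^bsub>F'\<^esub> free_gen R (f (fst p), g (snd p)))))"


section \<open>Sequential direct and inverse limits\<close>

text \<open>
  Direct limit of modules $F_i$ with transition maps $t_{ij} \colon F_i \to F_j$ for $i \le j$,
  as the disjoint union of the $F_i$ modulo eventual equality.
\<close>

definition dirlim_class ::
  "(nat \<Rightarrow> ('a, 'm, 'x) module_scheme) \<Rightarrow> (nat \<Rightarrow> nat \<Rightarrow> 'm \<Rightarrow> 'm) \<Rightarrow> nat \<times> 'm \<Rightarrow> (nat \<times> 'm) set"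
  where "dirlim_class F t p =
    {(j, y). y \<in> carrier (F j) \<and> (\<exists>l\<ge>max (fst p) j. t (fst p) l (snd p) = t j l y)}"

definition dirlim ::
  "(nat \<Rightarrow> ('a, 'm, 'x) module_scheme) \<Rightarrow> (nat \<Rightarrow> nat \<Rightarrow> 'm \<Rightarrow> 'm) \<Rightarrow> ('a, (nat \<times> 'm) set) module"
  where "dirlim F t =
    mk_module
      (dirlim_class F t ` (SIGMA i:UNIV. carrier (F i)))
      (dirlim_class F t (0, \<zero>\<^bsub>F 0\<^esub>))
      (\<lambda>X Y. \<Union>(i, x)\<in>X. \<Union>(j, y)\<in>Y.
         dirlim_class F t (max i j, t i (max i j) x \<oplus>\<^bsub>F (max i j)\<^esub> t j (max i j) y))
      (\<lambda>r X. \<Union>(i, x)\<in>X. dirlim_class F t (i, r \<odot>\<^bsub>F i\<^esub> x))"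

text \<open>
  Inverse limit of modules $F_i$ with transition maps $s_{ji} \colon F_j \to F_i$ for $i \le j$,
  as compatible families.
\<close>

definition invlim ::
  "(nat \<Rightarrow> ('a, 'm, 'x) module_scheme) \<Rightarrow> (nat \<Rightarrow> nat \<Rightarrow> 'm \<Rightarrow> 'm) \<Rightarrow> ('a, nat \<Rightarrow> 'm) module"
  where "invlim F s =
    mk_module
      {x. (\<forall>i. x i \<in> carrier (F i)) \<and> (\<forall>i j. i \<le> j \<longrightarrow> s j i (x j) = x i)}
      (\<lambda>i. \<zero>\<^bsub>F i\<^esub>)
      (\<lambda>x y i. x i \<oplus>\<^bsub>F i\<^esub> y i)
      (\<lambda>r x i. r \<odot>\<^bsub>F i\<^esub> x i)"


section \<open>Torsion, completion, reduced and coreduced modules\<close>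

text \<open>Powers are taken in the library's monoid of ideals, so the zeroth power is the whole
  ring.\<close>

definition ideal_pow :: "('a, 'r) ring_scheme \<Rightarrow> 'a set \<Rightarrow> nat \<Rightarrow> 'a set"
  where "ideal_pow R I k = I [^]\<^bsub>ideals_set R\<^esub> k"

definition ring_mod_pow :: "('a, 'r) ring_scheme \<Rightarrow> 'a set \<Rightarrow> nat \<Rightarrow> ('a, 'a set) module"
  where "ring_mod_pow R I k = quot_module (regular_module R) (ideal_pow R I k)"

text \<open>The projection $A/\mathfrak{a}^j \to A/\mathfrak{a}^i$ for $i \le j$: it sends the coset
  $\mathfrak{a}^j + x$ to $\mathfrak{a}^i + (\mathfrak{a}^j + x) = \mathfrak{a}^i + x$.\<close>

definition pow_proj :: "('a, 'r) ring_scheme \<Rightarrow> 'a set \<Rightarrow> nat \<Rightarrow> nat \<Rightarrow> 'a set \<Rightarrow> 'a set"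
  where "pow_proj R I j i = (\<lambda>X\<in>carrier (ring_mod_pow R I j). ideal_pow R I i <+>\<^bsub>R\<^esub> X)"

definition Gamma ::
  "('a, 'r) ring_scheme \<Rightarrow> 'a set \<Rightarrow> ('a, 'm, 'x) module_scheme
    \<Rightarrow> ('a, (nat \<times> ('a set \<Rightarrow> 'm)) set) module"
  where "Gamma R I M =
    dirlim (\<lambda>k. Hom_module R (ring_mod_pow R I k) M)
      (\<lambda>i j f. \<lambda>X\<in>carrier (ring_mod_pow R I j). f (pow_proj R I j i X))"

definition Lambda ::
  "('a, 'r) ring_scheme \<Rightarrow> 'a set \<Rightarrow> ('a, 'm, 'x) module_scheme
    \<Rightarrow> ('a, nat \<Rightarrow> ('a set \<times> 'm \<Rightarrow> 'a) set) module"
  where "Lambda R I M =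
    invlim (\<lambda>k. tensor_module R (ring_mod_pow R I k) M)
      (\<lambda>j i. tensor_map R (ring_mod_pow R I j) M (ring_mod_pow R I i) M
               (pow_proj R I j i) (\<lambda>m\<in>carrier M. m))"

text \<open>The submodule $I M$, consisting of the finite sums of products.\<close>

definition ideal_smult ::
  "('a, 'r) ring_scheme \<Rightarrow> 'a set \<Rightarrow> ('a, 'm, 'x) module_scheme \<Rightarrow> 'm set"
  where "ideal_smult R I M =
    submodule_span R M {r \<odot>\<^bsub>M\<^esub> x | r x. r \<in> I \<and> x \<in> carrier M}"

text \<open>Being torsion or complete asks for some isomorphism of modules; it is not required to be the
  canonical map.\<close>

definition torsion_module ::
  "('a, 'r) ring_scheme \<Rightarrow> 'a set \<Rightarrow> ('a, 'm, 'x) module_scheme \<Rightarrow> bool"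
  where "torsion_module R I M \<longleftrightarrow> mod_iso R (Gamma R I M) M"

definition complete_module ::
  "('a, 'r) ring_scheme \<Rightarrow> 'a set \<Rightarrow> ('a, 'm, 'x) module_scheme \<Rightarrow> bool"
  where "complete_module R I M \<longleftrightarrow> mod_iso R M (Lambda R I M)"

definition reduced_module ::
  "('a, 'r) ring_scheme \<Rightarrow> 'a set \<Rightarrow> ('a, 'm, 'x) module_scheme \<Rightarrow> bool"
  where "reduced_module R I M \<longleftrightarrow>
    (\<forall>m\<in>carrier M. (\<forall>r\<in>ideal_pow R I 2. r \<odot>\<^bsub>M\<^esub> m = \<zero>\<^bsub>M\<^esub>) \<longrightarrow> (\<forall>r\<in>I. r \<odot>\<^bsub>M\<^esub> m = \<zero>\<^bsub>M\<^esub>))"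

definition coreduced_module ::
  "('a, 'r) ring_scheme \<Rightarrow> 'a set \<Rightarrow> ('a, 'm, 'x) module_scheme \<Rightarrow> bool"
  where "coreduced_module R I M \<longleftrightarrow> ideal_smult R I M = ideal_smult R (ideal_pow R I 2) M"


section \<open>Complexes\<close>

text \<open>
  The modules of a complex all live in one type; this is no restriction, since a family of modules
  indexed by the integers can be transported into a disjoint union of their carriers.
\<close>

record ('a, 'm) cochain =
  cx_mod :: "int \<Rightarrow> ('a, 'm) module"
  cx_diff :: "int \<Rightarrow> 'm \<Rightarrow> 'm"

definition complexes :: "('a, 'r) ring_scheme \<Rightarrow> ('a, 'm) cochain set"
  where "complexes R =
    {M. (\<forall>n. module R (cx_mod M n)) \<and>
        (\<forall>n. cx_diff M n \<in> mod_hom R (cx_mod M n) (cx_mod M (n + 1))) \<and>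
        (\<forall>n. \<forall>x\<in>carrier (cx_mod M n). cx_diff M (n + 1) (cx_diff M n x) = \<zero>\<^bsub>cx_mod M (n + 1 + 1)\<^esub>)}"

definition cx_iso ::
  "('a, 'r) ring_scheme \<Rightarrow> ('a, 'm) cochain \<Rightarrow> ('a, 'n) cochain \<Rightarrow> bool"
  where "cx_iso R M N \<longleftrightarrow>
    (\<exists>f. \<forall>n. f n \<in> mod_hom R (cx_mod M n) (cx_mod N n) \<and>
             bij_betw (f n) (carrier (cx_mod M n)) (carrier (cx_mod N n)) \<and>
             (\<forall>x\<in>carrier (cx_mod M n). f (n + 1) (cx_diff M n x) = cx_diff N n (f n x)))"

definition zero_cx :: "('a, unit) cochain"
  where "zero_cx =
    \<lparr>cx_mod = (\<lambda>n. mk_module {()} () (\<lambda>_ _. ()) (\<lambda>_ _. ())), cx_diff = (\<lambda>n _. ())\<rparr>"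

definition ideal_cx ::
  "('a, 'r) ring_scheme \<Rightarrow> 'a set \<Rightarrow> ('a, 'm) cochain \<Rightarrow> ('a, 'm) cochain"
  where "ideal_cx R I M =
    \<lparr>cx_mod = (\<lambda>n. (cx_mod M n)\<lparr>carrier := ideal_smult R I (cx_mod M n)\<rparr>),
     cx_diff = (\<lambda>n. restrict (cx_diff M n) (ideal_smult R I (cx_mod M n)))\<rparr>"

text \<open>A full subcategory of the category of complexes is determined by, and here represented by,
  its class of objects; intersection and equality of full subcategories are those of the object
  classes.\<close>

definition cx_tor :: "('a, 'r) ring_scheme \<Rightarrow> 'a set \<Rightarrow> ('a, 'm) cochain set"
  where "cx_tor R I = {M \<in> complexes R. \<forall>n. torsion_module R I (cx_mod M n)}"

definition cx_com :: "('a, 'r) ring_scheme \<Rightarrow> 'a set \<Rightarrow> ('a, 'm) cochain set"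
  where "cx_com R I = {M \<in> complexes R. \<forall>n. complete_module R I (cx_mod M n)}"

definition cx_red :: "('a, 'r) ring_scheme \<Rightarrow> 'a set \<Rightarrow> ('a, 'm) cochain set"
  where "cx_red R I = {M \<in> complexes R. \<forall>n. reduced_module R I (cx_mod M n)}"

definition cx_cor :: "('a, 'r) ring_scheme \<Rightarrow> 'a set \<Rightarrow> ('a, 'm) cochain set"
  where "cx_cor R I = {M \<in> complexes R. \<forall>n. coreduced_module R I (cx_mod M n)}"

end

theory Submission
  imports Defs
begin

text \<open>
For a single module $M$ over a commutative ring $R$ with an ideal $I$, being torsion and reduced,
being complete and coreduced, and being killed by $I$ are the same condition. The statement on
complexes follows by reading this in every degree; that $I M$ is isomorphic to the zero complex just
says $I M^n = 0$ for all $n$.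

\<^bold>\<open>Torsion and reduced.\<close> A homomorphism $R/I^k \to M$ is determined by the image of $1$, which can be
any element killed by $I^k$. The direct limit $\Gamma_I(M)$ is therefore the submodule of those
elements of $M$ that some power of $I$ kills, and $M$ is torsion iff this is all of $M$
(\<open>torsion_module_iff\<close>). In a reduced module an element killed by a power of $I$ is killed by $I$
itself (\<open>torsion_and_reduced_iff\<close>).

\<^bold>\<open>Complete and coreduced.\<close> If $I M = I^2 M$ then $I M \subseteq I^k M$ for all $k$
(\<open>coreduced_ideal_smult_subset\<close>), so $I$ kills $R/I^k \otimes M$: moving a scalar from $I$ into the
second factor produces elements of $I^k M$, and moving the coefficients in $I^k$ back into the first
factor gives zero. Hence $I$ kills the inverse limit $\Lambda_I(M)$, and with it any module isomorphic
to it (\<open>complete_coreduced_imp_killed\<close>). Conversely, if $I M = 0$, every $R/I^k \otimes M$ with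
$k \ge 1$ is a copy of $M$ via $x \mapsto 1 \otimes x$, the transition maps are identities under this
identification, and the limit is $M$ (\<open>killed_imp_complete\<close>).

Torsion and completeness are given by arbitrary isomorphisms. This is enough because both properties
drawn from them, that every element is killed by a power of $I$ and that $I$ kills the whole module,
pass along every linear bijection.

Most of the remaining text makes the constructions usable: quotient modules and their universal
property, free modules with linear extension of maps, and tensor products with generation by pure
tensors, the universal property and the value of $f \otimes g$ on pure tensors.
\<close>

section \<open>Homomorphisms\<close>

lemma mk_module_simps [simp]:
  "carrier (mk_module S z pl sm) = S"
  "zero (mk_module S z pl sm) = z"
  "add (mk_module S z pl sm) = pl"
  "smult (mk_module S z pl sm) = sm"
  by (simp_all add: mk_module_def)

lemma mod_hom_PiE: "f \<in> mod_hom R M N \<Longrightarrow> f \<in> carrier M \<rightarrow>\<^sub>E carrier N"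
  unfolding mod_hom_def by blast

lemma mod_homD:
  assumes "f \<in> mod_hom R M N"
  shows "x \<in> carrier M \<Longrightarrow> f x \<in> carrier N"
    and "x \<in> carrier M \<Longrightarrow> y \<in> carrier M \<Longrightarrow> f (x \<oplus>\<^bsub>M\<^esub> y) = f x \<oplus>\<^bsub>N\<^esub> f y"
    and "r \<in> carrier R \<Longrightarrow> x \<in> carrier M \<Longrightarrow> f (r \<odot>\<^bsub>M\<^esub> x) = r \<odot>\<^bsub>N\<^esub> f x"
  using assms by (auto simp: mod_hom_def)

lemma mod_hom_restrictI:
  assumes "module R M"
    and "\<And>x. x \<in> carrier M \<Longrightarrow> f x \<in> carrier N"
    and "\<And>x y. \<lbrakk>x \<in> carrier M; y \<in> carrier M\<rbrakk> \<Longrightarrow> f (x \<oplus>\<^bsub>M\<^esub> y) = f x \<oplus>\<^bsub>N\<^esub> f y"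
    and "\<And>r x. \<lbrakk>r \<in> carrier R; x \<in> carrier M\<rbrakk> \<Longrightarrow> f (r \<odot>\<^bsub>M\<^esub> x) = r \<odot>\<^bsub>N\<^esub> f x"
  shows "(\<lambda>x\<in>carrier M. f x) \<in> mod_hom R M N"
proof -
  interpret M: module R M by fact
  show ?thesis using assms(2-) by (auto simp: mod_hom_def)
qed

section \<open>Submodules\<close>

lemma (in module) submodule_zero: "submodule H R M \<Longrightarrow> \<zero>\<^bsub>M\<^esub> \<in> H"
  using subgroup.one_closed[OF submodule.axioms(1), of H R M] by simp

lemma (in module) zero_submodule: "submodule {\<zero>\<^bsub>M\<^esub>} R M"
  by (rule submoduleI) auto

text \<open>
Linearity is assumed of $f$ on the carrier only, not as membership in \<^const>\<open>mod_hom\<close>, so that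
the lemma applies to multiplication by a scalar, to coset projections and to linear extensions
without first restricting them. Most arguments below in which a property spreads
from generators to a whole module take the preimage of a submodule in this way.
\<close>

lemma (in module) submodule_vimage:
  assumes "module R N" and H: "submodule H R N"
    and cl: "\<And>x. x \<in> carrier M \<Longrightarrow> f x \<in> carrier N"
    and ad: "\<And>x y. \<lbrakk>x \<in> carrier M; y \<in> carrier M\<rbrakk> \<Longrightarrow> f (x \<oplus>\<^bsub>M\<^esub> y) = f x \<oplus>\<^bsub>N\<^esub> f y"
    and sm: "\<And>r x. \<lbrakk>r \<in> carrier R; x \<in> carrier M\<rbrakk> \<Longrightarrow> f (r \<odot>\<^bsub>M\<^esub> x) = r \<odot>\<^bsub>N\<^esub> f x"
  shows "submodule {x \<in> carrier M. f x \<in> H} R M"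
proof -
  interpret N: module R N by fact
  have neg: "\<ominus>\<^bsub>M\<^esub> x = (\<ominus>\<^bsub>R\<^esub> \<one>\<^bsub>R\<^esub>) \<odot>\<^bsub>M\<^esub> x" if "x \<in> carrier M" for x
    using that smult_l_minus[of "\<one>\<^bsub>R\<^esub>" x] by simp
  have z: "f \<zero>\<^bsub>M\<^esub> = \<zero>\<^bsub>N\<^esub>"
    using sm[of "\<zero>\<^bsub>R\<^esub>" "\<zero>\<^bsub>M\<^esub>"] cl[of "\<zero>\<^bsub>M\<^esub>"] by simp
  show ?thesis
  proof (rule submoduleI)
    show "\<ominus>\<^bsub>M\<^esub> x \<in> {x \<in> carrier M. f x \<in> H}" if "x \<in> {x \<in> carrier M. f x \<in> H}" for x
      using that N.submoduleE(4)[OF H] by (simp add: neg sm)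
  qed (use N.submoduleE(4,5)[OF H] N.submodule_zero[OF H] z in \<open>simp_all add: ad sm subset_iff\<close>)
qed

lemma (in module) submodule_span_least:
  "\<lbrakk>submodule H R M; S \<subseteq> H\<rbrakk> \<Longrightarrow> submodule_span R M S \<subseteq> H"
  unfolding submodule_span_def by blast

lemma submodule_span_superset: "S \<subseteq> submodule_span R M S"
  unfolding submodule_span_def by blast

lemma (in module) submodule_span_submodule:
  assumes "S \<subseteq> carrier M"
  shows "submodule (submodule_span R M S) R M"
proof -
  have "submodule_span R M S \<subseteq> carrier M"
    using submodule_span_least[OF carrier_is_submodule assms] .
  then show ?thesis
    unfolding submodule_span_def
    by (intro submoduleI) (simp_all add: submodule_zero submoduleE(3-5))
qed

lemma (in module) smult_in_ideal_smult:
  "\<lbrakk>r \<in> I; x \<in> carrier M\<rbrakk> \<Longrightarrow> r \<odot>\<^bsub>M\<^esub> x \<in> ideal_smult R I M"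
  unfolding ideal_smult_def by (rule subsetD[OF submodule_span_superset]) blast

lemma (in module) ideal_smult_submodule:
  "I \<subseteq> carrier R \<Longrightarrow> submodule (ideal_smult R I M) R M"
  unfolding ideal_smult_def by (rule submodule_span_submodule) auto

lemma (in module) ideal_smult_least:
  assumes "submodule H R M" "\<And>r x. \<lbrakk>r \<in> I; x \<in> carrier M\<rbrakk> \<Longrightarrow> r \<odot>\<^bsub>M\<^esub> x \<in> H"
  shows "ideal_smult R I M \<subseteq> H"
  unfolding ideal_smult_def using assms by (intro submodule_span_least) auto

section \<open>Quotient modules\<close>

lemma (in module) submodule_abelian_subgroup:
  "submodule K R M \<Longrightarrow> abelian_subgroup K M"
  by (intro abelian_subgroupI3 additive_subgroupI submodule.axioms(1) abelian_group_axioms)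

lemma (in module) coset_eq_iff:
  assumes "submodule K R M" "x \<in> carrier M" "y \<in> carrier M"
  shows "K +>\<^bsub>M\<^esub> x = K +>\<^bsub>M\<^esub> y \<longleftrightarrow> x \<ominus>\<^bsub>M\<^esub> y \<in> K"
proof -
  interpret K: abelian_subgroup K M using submodule_abelian_subgroup[OF assms(1)] .
  have "x \<ominus>\<^bsub>M\<^esub> y \<in> K \<longleftrightarrow> x \<in> K +>\<^bsub>M\<^esub> y"
    using K.a_rcos_module[of y x] assms(2,3) by (simp add: a_minus_def K.is_abelian_subgroup)
  then show ?thesis
    using K.a_repr_independence' K.a_rcos_self assms by metis
qed

lemma (in module) coset_zero_iff:
  assumes "submodule K R M" "x \<in> carrier M"
  shows "K +>\<^bsub>M\<^esub> x = K \<longleftrightarrow> x \<in> K"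
proof -
  interpret K: abelian_subgroup K M using submodule_abelian_subgroup[OF assms(1)] .
  show ?thesis using K.a_rcos_const K.a_rcos_self assms by metis
qed

lemma carrier_quot_module:
  "carrier (quot_module M K) = (\<lambda>x. K +>\<^bsub>M\<^esub> x) ` carrier M"
  by (auto simp: quot_module_def A_RCOSETS_def' )

lemma zero_quot_module [simp]: "\<zero>\<^bsub>quot_module M K\<^esub> = K"
  by (simp add: quot_module_def)

lemma (in module) add_quot_module:
  assumes "submodule K R M" "x \<in> carrier M" "y \<in> carrier M"
  shows "(K +>\<^bsub>M\<^esub> x) \<oplus>\<^bsub>quot_module M K\<^esub> (K +>\<^bsub>M\<^esub> y) = K +>\<^bsub>M\<^esub> (x \<oplus>\<^bsub>M\<^esub> y)"
  using abelian_subgroup.a_rcos_sum[OF submodule_abelian_subgroup[OF assms(1)]] assms(2,3)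
  by (simp add: quot_module_def)

text \<open>
Scalar multiplication on a quotient and the tensor product of two maps are both defined as unions
over the representatives of a coset. This lemma evaluates such a union at one chosen representative.
\<close>

lemma (in module) UN_coset_const:
  assumes "submodule K R M" "x \<in> carrier M"
    and "\<And>u. \<lbrakk>u \<in> carrier M; u \<ominus>\<^bsub>M\<^esub> x \<in> K\<rbrakk> \<Longrightarrow> G u = G x"
  shows "(\<Union>u\<in>K +>\<^bsub>M\<^esub> x. G u) = G x"
proof -
  interpret K: abelian_subgroup K M using submodule_abelian_subgroup[OF assms(1)] .
  have "G u = G x" if "u \<in> K +>\<^bsub>M\<^esub> x" for u
  proof -
    have u: "u \<in> carrier M" using that K.a_elemrcos_carrier assms(2) by blast
    moreover have "K +>\<^bsub>M\<^esub> u = K +>\<^bsub>M\<^esub> x" using that K.a_repr_independence' assms(2) by metis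
    ultimately show ?thesis using assms coset_eq_iff by blast
  qed
  moreover have "x \<in> K +>\<^bsub>M\<^esub> x" using assms(2) by (rule K.a_rcos_self)
  ultimately show ?thesis by blast
qed

lemma (in module) smult_diff:
  "\<lbrakk>r \<in> carrier R; x \<in> carrier M; y \<in> carrier M\<rbrakk> \<Longrightarrow>
    r \<odot>\<^bsub>M\<^esub> (x \<ominus>\<^bsub>M\<^esub> y) = r \<odot>\<^bsub>M\<^esub> x \<ominus>\<^bsub>M\<^esub> r \<odot>\<^bsub>M\<^esub> y"
  by (simp add: a_minus_def smult_r_distr smult_r_minus)

lemma (in module) smult_quot_module:
  assumes K: "submodule K R M" and r: "r \<in> carrier R" and x: "x \<in> carrier M"
  shows "r \<odot>\<^bsub>quot_module M K\<^esub> (K +>\<^bsub>M\<^esub> x) = K +>\<^bsub>M\<^esub> (r \<odot>\<^bsub>M\<^esub> x)"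
proof -
  have "K +>\<^bsub>M\<^esub> (r \<odot>\<^bsub>M\<^esub> u) = K +>\<^bsub>M\<^esub> (r \<odot>\<^bsub>M\<^esub> x)"
    if "u \<in> carrier M" "u \<ominus>\<^bsub>M\<^esub> x \<in> K" for u
    using submoduleE(4)[OF K r that(2)] that(1) r x by (simp add: coset_eq_iff[OF K] smult_diff)
  then show ?thesis
    using UN_coset_const[OF K x, of "\<lambda>u. K +>\<^bsub>M\<^esub> (r \<odot>\<^bsub>M\<^esub> u)"] by (simp add: quot_module_def)
qed

lemma (in module) quot_module_is_module:
  assumes K: "submodule K R M"
  shows "module R (quot_module M K)"
proof (rule moduleI)
  note q = carrier_quot_module add_quot_module[OF K] smult_quot_module[OF K]
  have z: "K = K +>\<^bsub>M\<^esub> \<zero>\<^bsub>M\<^esub>"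
    using coset_zero_iff[OF K zero_closed] submodule_zero[OF K] by simp
  show "cring R" by (rule R.is_cring)
  show "abelian_group (quot_module M K)"
  proof (rule abelian_groupI)
    fix X assume "X \<in> carrier (quot_module M K)"
    then obtain x where x: "x \<in> carrier M" "X = K +>\<^bsub>M\<^esub> x" by (auto simp: q)
    then show "\<exists>Y\<in>carrier (quot_module M K). Y \<oplus>\<^bsub>quot_module M K\<^esub> X = \<zero>\<^bsub>quot_module M K\<^esub>"
      by (intro bexI[of _ "K +>\<^bsub>M\<^esub> (\<ominus>\<^bsub>M\<^esub> x)"]) (auto simp: q l_neg z[symmetric])
    show "\<zero>\<^bsub>quot_module M K\<^esub> \<oplus>\<^bsub>quot_module M K\<^esub> X = X"
      using q(2)[OF zero_closed x(1)] x by (simp add: z[symmetric])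
  next
    show "\<zero>\<^bsub>quot_module M K\<^esub> \<in> carrier (quot_module M K)"
      using z by (auto simp: q)
  qed (auto simp: q M.add.m_ac)
qed (auto simp: smult_l_distr smult_r_distr smult_assoc1
  carrier_quot_module add_quot_module[OF K] smult_quot_module[OF K])

lemma (in module) quot_module_lift:
  assumes K: "submodule K R M" and "module R P"
    and cl: "\<And>x. x \<in> carrier M \<Longrightarrow> f x \<in> carrier P"
    and ad: "\<And>x y. \<lbrakk>x \<in> carrier M; y \<in> carrier M\<rbrakk> \<Longrightarrow> f (x \<oplus>\<^bsub>M\<^esub> y) = f x \<oplus>\<^bsub>P\<^esub> f y"
    and sm: "\<And>r x. \<lbrakk>r \<in> carrier R; x \<in> carrier M\<rbrakk> \<Longrightarrow> f (r \<odot>\<^bsub>M\<^esub> x) = r \<odot>\<^bsub>P\<^esub> f x"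
    and ker: "\<And>x. x \<in> K \<Longrightarrow> f x = \<zero>\<^bsub>P\<^esub>"
  shows "\<exists>g\<in>mod_hom R (quot_module M K) P. \<forall>x\<in>carrier M. g (K +>\<^bsub>M\<^esub> x) = f x"
proof -
  interpret P: module R P by fact
  interpret Q: module R "quot_module M K" using K by (rule quot_module_is_module)
  define g where "g X = f (SOME x. x \<in> carrier M \<and> X = K +>\<^bsub>M\<^esub> x)" for X
  have g: "g (K +>\<^bsub>M\<^esub> x) = f x" if x: "x \<in> carrier M" for x
  proof -
    define y where "y = (SOME y. y \<in> carrier M \<and> K +>\<^bsub>M\<^esub> x = K +>\<^bsub>M\<^esub> y)"
    have "y \<in> carrier M \<and> K +>\<^bsub>M\<^esub> x = K +>\<^bsub>M\<^esub> y"
      unfolding y_def by (rule someI[of _ x]) (use x in simp)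
    then have y: "y \<in> carrier M" "y \<ominus>\<^bsub>M\<^esub> x \<in> K"
      using coset_eq_iff[OF K, of y x] x by auto
    have "y = (y \<ominus>\<^bsub>M\<^esub> x) \<oplus>\<^bsub>M\<^esub> x" using x y(1) by (simp add: a_minus_def a_assoc l_neg)
    then have "f y = f (y \<ominus>\<^bsub>M\<^esub> x) \<oplus>\<^bsub>P\<^esub> f x" using ad[of "y \<ominus>\<^bsub>M\<^esub> x" x] x y by simp
    then show ?thesis using ker[OF y(2)] cl[OF x] by (simp add: g_def y_def)
  qed
  have "restrict g (carrier (quot_module M K)) \<in> mod_hom R (quot_module M K) P"
    by (rule mod_hom_restrictI[OF Q.module_axioms])
      (auto simp: carrier_quot_module add_quot_module[OF K] smult_quot_module[OF K] g cl ad sm)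
  then show ?thesis
    by (intro bexI[of _ "restrict g (carrier (quot_module M K))"]) (auto simp: g carrier_quot_module)
qed

section \<open>Powers of an ideal\<close>

lemma (in cring) ideal_pow_0 [simp]: "ideal_pow R I 0 = carrier R"
  using comm_monoid.axioms(1)[OF ideals_set_is_comm_monoid]
  by (simp add: ideal_pow_def monoid.nat_pow_0 ideals_set_def)

lemma (in cring) ideal_pow_Suc: "ideal_pow R I (Suc k) = ideal_pow R I k \<cdot>\<^bsub>R\<^esub> I"
  using comm_monoid.axioms(1)[OF ideals_set_is_comm_monoid]
  by (simp add: ideal_pow_def monoid.nat_pow_Suc ideals_set_def)

lemma (in cring) ideal_pow_ideal: "ideal I R \<Longrightarrow> ideal (ideal_pow R I k) R"
  by (induction k) (simp_all add: oneideal ideal_pow_Suc ideal_prod_is_ideal)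

lemma (in cring) ideal_pow_subset_carrier: "ideal I R \<Longrightarrow> ideal_pow R I k \<subseteq> carrier R"
  using ideal.Icarr[OF ideal_pow_ideal] by blast

lemma (in cring) ideal_pow_Suc_0 [simp]: "ideal I R \<Longrightarrow> ideal_pow R I (Suc 0) = I"
  by (simp add: ideal_pow_Suc ideal_prod_one ideal_prod_commute oneideal)

lemma (in cring) ideal_pow_2: "ideal I R \<Longrightarrow> ideal_pow R I 2 = I \<cdot>\<^bsub>R\<^esub> I"
  by (simp add: numeral_2_eq_2 ideal_pow_Suc[of I "Suc 0"])

lemma (in cring) ideal_pow_antimono:
  assumes I: "ideal I R" and "i \<le> j"
  shows "ideal_pow R I j \<subseteq> ideal_pow R I i"
  using assms(2)
proof (induction rule: dec_induct)
  case (step n)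
  then show ?case using ideal_prod_inter[OF ideal_pow_ideal[OF I] I] by (auto simp: ideal_pow_Suc)
qed simp

text \<open>
The product of two ideals consists of sums of products, so a submodule absorbs $(IJ)x$ as soon as it
absorbs $r s x$ for all $r \in I$ and $s \in J$.
\<close>

lemma (in module) ideal_prod_smult_mem:
  assumes H: "submodule H R M" and IJ: "I \<subseteq> carrier R" "J \<subseteq> carrier R" and x: "x \<in> carrier M"
    and mem: "\<And>r s. \<lbrakk>r \<in> I; s \<in> J\<rbrakk> \<Longrightarrow> r \<odot>\<^bsub>M\<^esub> (s \<odot>\<^bsub>M\<^esub> x) \<in> H"
    and r: "r \<in> I \<cdot>\<^bsub>R\<^esub> J"
  shows "r \<odot>\<^bsub>M\<^esub> x \<in> H"
proof -
  have "r \<in> carrier R \<and> r \<odot>\<^bsub>M\<^esub> x \<in> H"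
    using r
  proof induction
    case (prod i j)
    then show ?case using IJ x mem[OF prod] by (auto simp: smult_assoc1 subset_iff)
  next
    case (sum s t)
    then show ?case using x submoduleE(5)[OF H] by (auto simp: smult_l_distr)
  qed
  then show ?thesis ..
qed

section \<open>The cyclic modules of an adic system\<close>

definition residue :: "('a, 'r) ring_scheme \<Rightarrow> 'a set \<Rightarrow> nat \<Rightarrow> 'a \<Rightarrow> 'a set"
  where "residue R I k r = ideal_pow R I k +>\<^bsub>R\<^esub> r"

lemma (in cring) regular_module_is_module: "module R (regular_module R)"
  unfolding regular_module_def
  by (rule moduleI[OF is_cring], rule abelian_groupI)
    (auto simp: l_distr r_distr m_assoc a_ac intro: bexI[OF _ a_inv_closed] l_neg)

lemma (in cring) ideal_submodule_regular:
  assumes "ideal J R" shows "submodule J R (regular_module R)"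
proof -
  interpret J: ideal J R by fact
  have "\<ominus>\<^bsub>regular_module R\<^esub> a = \<ominus>\<^bsub>R\<^esub> a" for a
    by (simp add: a_inv_def m_inv_def regular_module_def)
  then show ?thesis
    by (intro module.submoduleI[OF regular_module_is_module])
      (auto simp: regular_module_def J.I_l_closed)
qed

lemma residue_regular:
  "ideal_pow R I k +>\<^bsub>regular_module R\<^esub> r = residue R I k r"
  by (simp add: residue_def a_r_coset_def' regular_module_def)

context cring
begin

lemma ring_mod_pow_module: "ideal I R \<Longrightarrow> module R (ring_mod_pow R I k)"
  unfolding ring_mod_pow_def
  by (intro module.quot_module_is_module regular_module_is_module ideal_submodule_regular
      ideal_pow_ideal)

lemma carrier_ring_mod_pow: "carrier (ring_mod_pow R I k) = residue R I k ` carrier R"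
  by (simp add: ring_mod_pow_def carrier_quot_module residue_regular) (simp add: regular_module_def)

lemma residue_in_carrier [simp]: "r \<in> carrier R \<Longrightarrow> residue R I k r \<in> carrier (ring_mod_pow R I k)"
  by (simp add: carrier_ring_mod_pow)

lemma add_residue:
  assumes "ideal I R" "r \<in> carrier R" "s \<in> carrier R"
  shows "residue R I k r \<oplus>\<^bsub>ring_mod_pow R I k\<^esub> residue R I k s = residue R I k (r \<oplus> s)"
  using module.add_quot_module[OF regular_module_is_module
      ideal_submodule_regular[OF ideal_pow_ideal[OF assms(1)]], of r s k] assms(2,3)
  by (simp add: residue_regular ring_mod_pow_def) (simp add: regular_module_def)

lemma smult_residue:
  assumes "ideal I R" "r \<in> carrier R" "s \<in> carrier R"
  shows "r \<odot>\<^bsub>ring_mod_pow R I k\<^esub> residue R I k s = residue R I k (r \<otimes> s)"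
  using module.smult_quot_module[OF regular_module_is_module
      ideal_submodule_regular[OF ideal_pow_ideal[OF assms(1)]], of r s k] assms(2,3)
  by (simp add: residue_regular ring_mod_pow_def) (simp add: regular_module_def)

lemma residue_eq_zero:
  assumes "ideal I R" "r \<in> ideal_pow R I k"
  shows "residue R I k r = \<zero>\<^bsub>ring_mod_pow R I k\<^esub>"
  using module.coset_zero_iff[OF regular_module_is_module
      ideal_submodule_regular[OF ideal_pow_ideal[OF assms(1)]], of r k] assms(2)
    ideal_pow_subset_carrier[OF assms(1), of k]
  by (auto simp: residue_regular ring_mod_pow_def) (auto simp: regular_module_def)

lemma residue_eq_smult_one:
  assumes "ideal I R" "r \<in> carrier R"
  shows "residue R I k r = r \<odot>\<^bsub>ring_mod_pow R I k\<^esub> residue R I k \<one>"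
  using assms by (simp add: smult_residue)

lemma pow_proj_residue:
  assumes I: "ideal I R" and ij: "i \<le> j" and r: "r \<in> carrier R"
  shows "pow_proj R I j i (residue R I j r) = residue R I i r"
proof -
  interpret Ij: ideal "ideal_pow R I j" R using I by (rule ideal_pow_ideal)
  interpret Ii: ideal "ideal_pow R I i" R using I by (rule ideal_pow_ideal)
  have sub: "ideal_pow R I j \<subseteq> ideal_pow R I i" using ideal_pow_antimono[OF I ij] .
  have "ideal_pow R I i <+>\<^bsub>R\<^esub> (ideal_pow R I j +>\<^bsub>R\<^esub> r) = ideal_pow R I i +> r"
  proof (intro equalityI subsetI)
    fix x assume "x \<in> ideal_pow R I i <+>\<^bsub>R\<^esub> (ideal_pow R I j +>\<^bsub>R\<^esub> r)"
    then obtain a b where ab: "a \<in> ideal_pow R I i" "b \<in> ideal_pow R I j" "x = a \<oplus> (b \<oplus> r)"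
      by (auto simp: set_add_def' a_r_coset_def')
    then have "x = (a \<oplus> b) \<oplus> r" using r by (simp add: a_assoc)
    moreover have "a \<oplus> b \<in> ideal_pow R I i" using ab sub by auto
    ultimately show "x \<in> ideal_pow R I i +>\<^bsub>R\<^esub> r" by (auto simp: a_r_coset_def')
  next
    fix x assume "x \<in> ideal_pow R I i +>\<^bsub>R\<^esub> r"
    then obtain a where a: "a \<in> ideal_pow R I i" "x = a \<oplus> (\<zero> \<oplus> r)"
      using r by (auto simp: a_r_coset_def')
    then show "x \<in> ideal_pow R I i <+>\<^bsub>R\<^esub> (ideal_pow R I j +>\<^bsub>R\<^esub> r)"
      using Ij.zero_closed unfolding set_add_def' a_r_coset_def' by blast
  qed
  then show ?thesis
    using residue_in_carrier[OF r, of I j] by (simp add: pow_proj_def residue_def)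
qed

lemma pow_proj_hom:
  assumes I: "ideal I R" and ij: "i \<le> j"
  shows "pow_proj R I j i \<in> mod_hom R (ring_mod_pow R I j) (ring_mod_pow R I i)"
proof -
  have "(\<lambda>X\<in>carrier (ring_mod_pow R I j). pow_proj R I j i X)
      \<in> mod_hom R (ring_mod_pow R I j) (ring_mod_pow R I i)"
    by (rule mod_hom_restrictI[OF ring_mod_pow_module[OF I]])
      (auto simp: carrier_ring_mod_pow pow_proj_residue[OF I ij] add_residue[OF I] smult_residue[OF I])
  moreover have "(\<lambda>X\<in>carrier (ring_mod_pow R I j). pow_proj R I j i X) = pow_proj R I j i"
    by (simp add: pow_proj_def restrict_def fun_eq_iff)
  ultimately show ?thesis by simp
qed

end

section \<open>Torsion\<close>

definition pow_torsion :: "('a, 'r) ring_scheme \<Rightarrow> 'a set \<Rightarrow> ('a, 'm, 'x) module_scheme \<Rightarrow> nat \<Rightarrow> 'm set"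
  where "pow_torsion R I M k = {x \<in> carrier M. \<forall>r\<in>ideal_pow R I k. r \<odot>\<^bsub>M\<^esub> x = \<zero>\<^bsub>M\<^esub>}"

context module
begin

text \<open>
$R/I^k$ is cyclic, generated by the class of $1$. A homomorphism $R/I^k \to M$ is therefore
determined by its value at that class (\<open>Hom_eqI\<close>), and the possible values are exactly the elements
killed by $I^k$ (\<open>Hom_value_in_pow_torsion\<close> and \<open>Hom_with_value\<close>).
\<close>

lemma Hom_residue:
  assumes I: "ideal I R" and f: "f \<in> mod_hom R (ring_mod_pow R I k) M" and r: "r \<in> carrier R"
  shows "f (residue R I k r) = r \<odot>\<^bsub>M\<^esub> f (residue R I k \<one>)"
  using mod_homD(3)[OF f r, of "residue R I k \<one>"] r
  by (simp add: residue_eq_smult_one[OF I r, symmetric])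

lemma Hom_eqI:
  assumes I: "ideal I R" and f: "f \<in> mod_hom R (ring_mod_pow R I k) M"
    and g: "g \<in> mod_hom R (ring_mod_pow R I k) M"
    and eq: "f (residue R I k \<one>) = g (residue R I k \<one>)"
  shows "f = g"
proof (rule ext)
  fix X
  show "f X = g X"
  proof (cases "X \<in> carrier (ring_mod_pow R I k)")
    case True
    then obtain r where r: "r \<in> carrier R" "X = residue R I k r"
      unfolding carrier_ring_mod_pow by blast
    show ?thesis
      unfolding r(2) Hom_residue[OF I f r(1)] Hom_residue[OF I g r(1)] eq ..
  next
    case False
    then show ?thesis
      using PiE_arb[OF mod_hom_PiE[OF f]] PiE_arb[OF mod_hom_PiE[OF g]] by simp
  qed
qed

lemma Hom_value_in_pow_torsion:
  assumes I: "ideal I R" and f: "f \<in> mod_hom R (ring_mod_pow R I k) M"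
  shows "f (residue R I k \<one>) \<in> pow_torsion R I M k"
proof -
  have "r \<odot>\<^bsub>M\<^esub> f (residue R I k \<one>) = \<zero>\<^bsub>M\<^esub>" if r: "r \<in> ideal_pow R I k" for r
  proof -
    interpret Q: module R "ring_mod_pow R I k" using I by (rule ring_mod_pow_module)
    have "r \<odot>\<^bsub>M\<^esub> f (residue R I k \<one>) = f \<zero>\<^bsub>ring_mod_pow R I k\<^esub>"
      using Hom_residue[OF I f, of r] residue_eq_zero[OF I r] r ideal_pow_subset_carrier[OF I, of k]
      by auto
    also have "\<dots> = \<zero>\<^bsub>M\<^esub>"
      using mod_homD(3)[OF f R.zero_closed Q.zero_closed] mod_homD(1)[OF f Q.zero_closed] by simp
    finally show ?thesis .
  qed
  then show ?thesis using mod_homD(1)[OF f residue_in_carrier[OF R.one_closed]]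
    by (simp add: pow_torsion_def)
qed

lemma Hom_with_value:
  assumes I: "ideal I R" and x: "x \<in> pow_torsion R I M k"
  shows "\<exists>f\<in>mod_hom R (ring_mod_pow R I k) M. \<forall>r\<in>carrier R. f (residue R I k r) = r \<odot>\<^bsub>M\<^esub> x"
proof -
  interpret A: module R "regular_module R" by (rule regular_module_is_module)
  have "\<exists>f\<in>mod_hom R (quot_module (regular_module R) (ideal_pow R I k)) M.
      \<forall>r\<in>carrier (regular_module R). f (ideal_pow R I k +>\<^bsub>regular_module R\<^esub> r) = r \<odot>\<^bsub>M\<^esub> x"
    using x
    by (intro A.quot_module_lift ideal_submodule_regular ideal_pow_ideal I module_axioms)
      (auto simp: regular_module_def pow_torsion_def smult_l_distr smult_assoc1)
  then show ?thesis
    by (simp add: residue_regular ring_mod_pow_def) (simp add: regular_module_def)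
qed

end

text \<open>
The element of the direct limit $\Gamma_I(M)$ that corresponds to $x \in M$: the set of all
homomorphisms, from any stage $R/I^j$, that send the class of $1$ to $x$. It is empty unless a power
of $I$ kills $x$.
\<close>

definition germ ::
  "('a, 'r) ring_scheme \<Rightarrow> 'a set \<Rightarrow> ('a, 'm, 'x) module_scheme \<Rightarrow> 'm \<Rightarrow> (nat \<times> ('a set \<Rightarrow> 'm)) set"
  where "germ R I M x =
    {(j, g). g \<in> mod_hom R (ring_mod_pow R I j) M \<and> g (residue R I j \<one>\<^bsub>R\<^esub>) = x}"

abbreviation (input) Hom_system ::
  "('a, 'r) ring_scheme \<Rightarrow> 'a set \<Rightarrow> ('a, 'm, 'x) module_scheme \<Rightarrow> nat \<Rightarrow> ('a, 'a set \<Rightarrow> 'm) module"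
  where "Hom_system R I M k \<equiv> Hom_module R (ring_mod_pow R I k) M"

abbreviation (input) Hom_transition ::
  "('a, 'r) ring_scheme \<Rightarrow> 'a set \<Rightarrow> nat \<Rightarrow> nat \<Rightarrow> ('a set \<Rightarrow> 'm) \<Rightarrow> 'a set \<Rightarrow> 'm"
  where "Hom_transition R I i j f \<equiv> \<lambda>X\<in>carrier (ring_mod_pow R I j). f (pow_proj R I j i X)"

context module
begin

lemma Hom_transition_hom:
  assumes I: "ideal I R" and ij: "i \<le> j" and f: "f \<in> mod_hom R (ring_mod_pow R I i) M"
  shows "Hom_transition R I i j f \<in> mod_hom R (ring_mod_pow R I j) M"
    and "Hom_transition R I i j f (residue R I j \<one>) = f (residue R I i \<one>)"
proof -
  note p = mod_homD[OF pow_proj_hom[OF I ij]] and f' = mod_homD[OF f]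
  show "Hom_transition R I i j f \<in> mod_hom R (ring_mod_pow R I j) M"
    by (rule mod_hom_restrictI[OF ring_mod_pow_module[OF I]]) (simp_all add: p f')
  show "Hom_transition R I i j f (residue R I j \<one>) = f (residue R I i \<one>)"
    by (simp add: pow_proj_residue[OF I ij])
qed

lemma Hom_module_add_closed:
  assumes "module R N" and f: "f \<in> mod_hom R N M" and g: "g \<in> mod_hom R N M"
  shows "f \<oplus>\<^bsub>Hom_module R N M\<^esub> g \<in> mod_hom R N M"
proof -
  note f' = mod_homD[OF f] and g' = mod_homD[OF g]
  show ?thesis
    unfolding Hom_module_def mk_module_simps
    by (rule mod_hom_restrictI[OF assms(1)]) (simp_all add: f' g' smult_r_distr M.add.m_ac)
qed

lemma Hom_module_smult_closed:
  assumes "module R N" and f: "f \<in> mod_hom R N M" and r: "r \<in> carrier R"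
  shows "r \<odot>\<^bsub>Hom_module R N M\<^esub> f \<in> mod_hom R N M"
proof -
  note f' = mod_homD[OF f]
  show ?thesis
    unfolding Hom_module_def mk_module_simps
    by (rule mod_hom_restrictI[OF assms(1)])
      (simp_all add: f' r smult_r_distr smult_assoc1[symmetric] R.m_comm)
qed

text \<open>
The transition maps preserve the value at the class of $1$, and two homomorphisms from the same
stage with equal values there coincide. Two homomorphisms therefore become equal at some later stage
exactly when their values agree, in which case they already agree at the larger of their two stages.
\<close>

lemma dirlim_class_Hom:
  assumes I: "ideal I R" and f: "f \<in> mod_hom R (ring_mod_pow R I i) M"
  shows "dirlim_class (Hom_system R I M) (Hom_transition R I) (i, f)
    = germ R I M (f (residue R I i \<one>))"
proof -
  have "(\<exists>l\<ge>max i j. Hom_transition R I i l f = Hom_transition R I j l g)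
      \<longleftrightarrow> g (residue R I j \<one>) = f (residue R I i \<one>)"
    (is "(\<exists>l\<ge>_. ?t i l f = ?t j l g) \<longleftrightarrow> _")
    if g: "g \<in> mod_hom R (ring_mod_pow R I j) M" for j g
  proof
    assume "\<exists>l\<ge>max i j. ?t i l f = ?t j l g"
    then obtain l where l: "i \<le> l" "j \<le> l" "?t i l f = ?t j l g" by auto
    show "g (residue R I j \<one>) = f (residue R I i \<one>)"
      using Hom_transition_hom(2)[OF I l(1) f] Hom_transition_hom(2)[OF I l(2) g] l(3) by metis
  next
    assume eq: "g (residue R I j \<one>) = f (residue R I i \<one>)"
    have le: "i \<le> max i j" "j \<le> max i j" by auto
    have "?t i (max i j) f = ?t j (max i j) g"
      by (rule Hom_eqI[OF I Hom_transition_hom(1)[OF I le(1) f] Hom_transition_hom(1)[OF I le(2) g]])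
        (simp only: Hom_transition_hom(2)[OF I le(1) f] Hom_transition_hom(2)[OF I le(2) g] eq)
    then show "\<exists>l\<ge>max i j. ?t i l f = ?t j l g" by blast
  qed
  then show ?thesis
    by (auto simp: dirlim_class_def germ_def Hom_module_def)
qed

lemma pow_torsion_mono:
  assumes "ideal I R" "i \<le> j"
  shows "pow_torsion R I M i \<subseteq> pow_torsion R I M j"
  using ideal_pow_antimono[OF assms] by (auto simp: pow_torsion_def)

lemma germ_inj:
  assumes I: "ideal I R" and x: "x \<in> pow_torsion R I M k" and eq: "germ R I M x = germ R I M y"
  shows "x = y"
proof -
  obtain f where "f \<in> mod_hom R (ring_mod_pow R I k) M" "f (residue R I k \<one>) = \<one> \<odot>\<^bsub>M\<^esub> x"
    using Hom_with_value[OF I x] by blast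
  then have "(k, f) \<in> germ R I M x" using x by (simp add: germ_def pow_torsion_def)
  then show ?thesis using eq by (auto simp: germ_def)
qed

lemma germ_nonempty:
  assumes I: "ideal I R" and x: "x \<in> pow_torsion R I M k"
  shows "germ R I M x \<noteq> {}"
  using Hom_with_value[OF I x] x by (force simp: germ_def pow_torsion_def)

lemma carrier_Gamma:
  assumes I: "ideal I R"
  shows "carrier (Gamma R I M) = germ R I M ` (\<Union>k. pow_torsion R I M k)"
proof (intro equalityI subsetI)
  fix X assume "X \<in> carrier (Gamma R I M)"
  then obtain i f where f: "f \<in> mod_hom R (ring_mod_pow R I i) M"
    and "X = dirlim_class (Hom_system R I M) (Hom_transition R I) (i, f)"
    by (auto simp: Gamma_def dirlim_def Hom_module_def)
  then show "X \<in> germ R I M ` (\<Union>k. pow_torsion R I M k)"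
    using Hom_value_in_pow_torsion[OF I f] dirlim_class_Hom[OF I f] by blast
next
  fix X assume "X \<in> germ R I M ` (\<Union>k. pow_torsion R I M k)"
  then obtain x k where x: "x \<in> pow_torsion R I M k" "X = germ R I M x" by blast
  obtain f where f: "f \<in> mod_hom R (ring_mod_pow R I k) M" "f (residue R I k \<one>) = \<one> \<odot>\<^bsub>M\<^esub> x"
    using Hom_with_value[OF I x(1)] by blast
  then have "X = dirlim_class (Hom_system R I M) (Hom_transition R I) (k, f)"
    using dirlim_class_Hom[OF I f(1)] x by (simp add: pow_torsion_def)
  then show "X \<in> carrier (Gamma R I M)"
    using f(1) by (force simp: Gamma_def dirlim_def Hom_module_def)
qed

lemma add_Gamma:
  assumes I: "ideal I R" and x: "x \<in> pow_torsion R I M i" and y: "y \<in> pow_torsion R I M j"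
  shows "germ R I M x \<oplus>\<^bsub>Gamma R I M\<^esub> germ R I M y = germ R I M (x \<oplus>\<^bsub>M\<^esub> y)"
proof -
  have "dirlim_class (Hom_system R I M) (Hom_transition R I) (max i j,
      Hom_transition R I i (max i j) f \<oplus>\<^bsub>Hom_system R I M (max i j)\<^esub> Hom_transition R I j (max i j) g)
    = germ R I M (x \<oplus>\<^bsub>M\<^esub> y)" if f: "(i, f) \<in> germ R I M x" and g: "(j, g) \<in> germ R I M y" for i j f g
  proof -
    have f': "f \<in> mod_hom R (ring_mod_pow R I i) M" "f (residue R I i \<one>) = x"
      and g': "g \<in> mod_hom R (ring_mod_pow R I j) M" "g (residue R I j \<one>) = y"
      using f g by (auto simp: germ_def)
    have le: "i \<le> max i j" "j \<le> max i j" by auto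
    note F = Hom_transition_hom[OF I le(1) f'(1)] and G = Hom_transition_hom[OF I le(2) g'(1)]
    note S = Hom_module_add_closed[OF ring_mod_pow_module[OF I] F(1) G(1)]
    show ?thesis
      unfolding dirlim_class_Hom[OF I S] using F(2) G(2) f'(2) g'(2)
      by (simp add: Hom_module_def)
  qed
  then show ?thesis
    using germ_nonempty[OF I x] germ_nonempty[OF I y]
    unfolding Gamma_def dirlim_def mk_module_simps by (fastforce simp: split_def)
qed

lemma smult_Gamma:
  assumes I: "ideal I R" and x: "x \<in> pow_torsion R I M i" and r: "r \<in> carrier R"
  shows "r \<odot>\<^bsub>Gamma R I M\<^esub> germ R I M x = germ R I M (r \<odot>\<^bsub>M\<^esub> x)"
proof -
  have "dirlim_class (Hom_system R I M) (Hom_transition R I) (i, r \<odot>\<^bsub>Hom_system R I M i\<^esub> f)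
    = germ R I M (r \<odot>\<^bsub>M\<^esub> x)" if f: "(i, f) \<in> germ R I M x" for i f
  proof -
    have f': "f \<in> mod_hom R (ring_mod_pow R I i) M" "f (residue R I i \<one>) = x"
      using f by (auto simp: germ_def)
    note S = Hom_module_smult_closed[OF ring_mod_pow_module[OF I] f'(1) r]
    show ?thesis
      unfolding dirlim_class_Hom[OF I S] using f'(2) by (simp add: Hom_module_def)
  qed
  then show ?thesis
    using germ_nonempty[OF I x]
    unfolding Gamma_def dirlim_def mk_module_simps by (fastforce simp: split_def)
qed

text \<open>
By the preceding lemmas $\Gamma_I(M)$ is the submodule of elements killed by a power of $I$. If that
submodule is all of $M$, evaluation at the class of $1$ is an isomorphism. Conversely an arbitrary
isomorphism suffices, because being killed by a power of $I$ is transported by any linear bijection.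
\<close>

theorem torsion_module_iff:
  assumes I: "ideal I R"
  shows "torsion_module R I M \<longleftrightarrow> carrier M = (\<Union>k. pow_torsion R I M k)"
proof
  assume "torsion_module R I M"
  then obtain h where h: "h \<in> mod_hom R (Gamma R I M) M"
    and bij: "bij_betw h (carrier (Gamma R I M)) (carrier M)"
    by (auto simp: torsion_module_def mod_iso_def)
  have "\<exists>k. x \<in> pow_torsion R I M k" if x: "x \<in> carrier M" for x
  proof -
    have "x \<in> h ` germ R I M ` (\<Union>k. pow_torsion R I M k)"
      using bij x unfolding carrier_Gamma[OF I, symmetric] by (simp add: bij_betw_def)
    then obtain y k where y: "y \<in> pow_torsion R I M k" "x = h (germ R I M y)"
      by blast
    have yG: "germ R I M y \<in> carrier (Gamma R I M)" using y(1) carrier_Gamma[OF I] by blast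
    \<comment> \<open>Multiplying by the scalar $0$ produces the zero of $\Gamma_I(M)$ in a form that $h$ maps to zero.\<close>
    have "r \<odot>\<^bsub>M\<^esub> x = \<zero>\<^bsub>M\<^esub>" if r: "r \<in> ideal_pow R I k" for r
    proof -
      have rR: "r \<in> carrier R" using r ideal_pow_subset_carrier[OF I] by blast
      have "r \<odot>\<^bsub>M\<^esub> y = \<zero> \<odot>\<^bsub>M\<^esub> y" using y(1) r by (simp add: pow_torsion_def)
      then have "r \<odot>\<^bsub>Gamma R I M\<^esub> germ R I M y = \<zero> \<odot>\<^bsub>Gamma R I M\<^esub> germ R I M y"
        by (simp add: smult_Gamma[OF I y(1)] rR)
      then have "r \<odot>\<^bsub>M\<^esub> x = \<zero> \<odot>\<^bsub>M\<^esub> x"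
        using mod_homD(3)[OF h rR yG] mod_homD(3)[OF h R.zero_closed yG] y(2) by simp
      then show ?thesis using x by simp
    qed
    then show ?thesis using x by (auto simp: pow_torsion_def)
  qed
  then show "carrier M = (\<Union>k. pow_torsion R I M k)" by (auto simp: pow_torsion_def)
next
  assume eq: "carrier M = (\<Union>k. pow_torsion R I M k)"
  have inj: "inj_on (germ R I M) (carrier M)"
    unfolding inj_on_def eq using germ_inj[OF I] by blast
  have G: "carrier (Gamma R I M) = germ R I M ` carrier M" unfolding carrier_Gamma[OF I] eq ..
  define h where "h = restrict (inv_into (carrier M) (germ R I M)) (carrier (Gamma R I M))"
  have h: "h (germ R I M x) = x" if "x \<in> carrier M" for x
    using that inj by (simp add: h_def G)
  have add: "germ R I M x \<oplus>\<^bsub>Gamma R I M\<^esub> germ R I M y = germ R I M (x \<oplus>\<^bsub>M\<^esub> y)"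
    if "x \<in> carrier M" "y \<in> carrier M" for x y
    using that add_Gamma[OF I] unfolding eq by blast
  have smult: "r \<odot>\<^bsub>Gamma R I M\<^esub> germ R I M x = germ R I M (r \<odot>\<^bsub>M\<^esub> x)"
    if "r \<in> carrier R" "x \<in> carrier M" for r x
    using that smult_Gamma[OF I] unfolding eq by blast
  have "h \<in> mod_hom R (Gamma R I M) M"
    unfolding mod_hom_def
  proof (intro CollectI conjI ballI)
    show "h \<in> carrier (Gamma R I M) \<rightarrow>\<^sub>E carrier M"
      by (rule PiE_I) (auto simp: G h, simp add: h_def G)
  qed (auto simp: G h add smult)
  moreover have "bij_betw h (carrier (Gamma R I M)) (carrier M)"
    by (rule bij_betwI[where g = "germ R I M"]) (auto simp: G h)
  ultimately show "torsion_module R I M" by (auto simp: torsion_module_def mod_iso_def)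
qed

text \<open>
Reducedness lowers the power of $I$ that kills an element: if $I^{k+2} x = 0$ and $s \in I^k$, then
$I^2 (s x) = 0$, hence $I (s x) = 0$; as $s$ varies this says $I^{k+1} x = 0$. In a torsion module
every element is killed by some power, so the descent ends with $I x = 0$ for all $x$.
\<close>

lemma torsion_and_reduced_iff:
  assumes I: "ideal I R"
  shows "torsion_module R I M \<and> reduced_module R I M \<longleftrightarrow> (\<forall>r\<in>I. \<forall>x\<in>carrier M. r \<odot>\<^bsub>M\<^esub> x = \<zero>\<^bsub>M\<^esub>)"
proof
  assume asm: "torsion_module R I M \<and> reduced_module R I M"
  interpret I: ideal I R by fact
  have step: "x \<in> pow_torsion R I M (Suc k)" if x: "x \<in> pow_torsion R I M (Suc (Suc k))" for x k
  proof -
    have xM: "x \<in> carrier M" using x by (simp add: pow_torsion_def)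
    have "s \<odot>\<^bsub>M\<^esub> (r \<odot>\<^bsub>M\<^esub> x) \<in> {\<zero>\<^bsub>M\<^esub>}" if s: "s \<in> ideal_pow R I k" and r: "r \<in> I" for s r
    proof -
      have sR: "s \<in> carrier R" using s ideal_pow_subset_carrier[OF I] by blast
      have "t \<odot>\<^bsub>M\<^esub> (s \<odot>\<^bsub>M\<^esub> x) \<in> {\<zero>\<^bsub>M\<^esub>}" if t: "t \<in> ideal_pow R I 2" for t
      proof (rule ideal_prod_smult_mem[OF zero_submodule I.a_subset I.a_subset])
        show "t \<in> I \<cdot>\<^bsub>R\<^esub> I" using t I by (simp add: ideal_pow_2)
        show "s \<odot>\<^bsub>M\<^esub> x \<in> carrier M" using sR xM by simp
        fix a b assume ab: "a \<in> I" "b \<in> I"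
        then have "s \<otimes> b \<otimes> a \<in> ideal_pow R I (Suc (Suc k))"
          using s by (simp add: ideal_pow_Suc ideal_prod.prod)
        then have "(s \<otimes> b \<otimes> a) \<odot>\<^bsub>M\<^esub> x = \<zero>\<^bsub>M\<^esub>" using x by (simp add: pow_torsion_def)
        moreover have "s \<otimes> b \<otimes> a = a \<otimes> (b \<otimes> s)" using ab sR I.Icarr by (simp add: R.m_ac)
        ultimately show "a \<odot>\<^bsub>M\<^esub> (b \<odot>\<^bsub>M\<^esub> (s \<odot>\<^bsub>M\<^esub> x)) \<in> {\<zero>\<^bsub>M\<^esub>}"
          using ab sR I.Icarr xM by (simp add: smult_assoc1)
      qed
      then have "r \<odot>\<^bsub>M\<^esub> (s \<odot>\<^bsub>M\<^esub> x) = \<zero>\<^bsub>M\<^esub>"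
        using asm r sR xM by (simp add: reduced_module_def)
      then show ?thesis using r I.Icarr sR xM by (simp add: smult_assoc1[symmetric] R.m_comm)
    qed
    then have "t \<odot>\<^bsub>M\<^esub> x \<in> {\<zero>\<^bsub>M\<^esub>}" if "t \<in> ideal_pow R I (Suc k)" for t
      using ideal_prod_smult_mem[OF zero_submodule ideal_pow_subset_carrier[OF I] I.a_subset xM] that
      unfolding ideal_pow_Suc by blast
    then show ?thesis using xM by (simp add: pow_torsion_def)
  qed
  have "pow_torsion R I M (Suc k) \<subseteq> pow_torsion R I M (Suc 0)" for k
    by (induction k) (use step in auto)
  moreover have "pow_torsion R I M k \<subseteq> pow_torsion R I M (Suc k)" for k
    using pow_torsion_mono[OF I, of k "Suc k"] by simp
  ultimately have "carrier M \<subseteq> pow_torsion R I M (Suc 0)"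
    using asm unfolding torsion_module_iff[OF I] by blast
  then show "\<forall>r\<in>I. \<forall>x\<in>carrier M. r \<odot>\<^bsub>M\<^esub> x = \<zero>\<^bsub>M\<^esub>"
    using I by (auto simp: pow_torsion_def)
next
  assume asm: "\<forall>r\<in>I. \<forall>x\<in>carrier M. r \<odot>\<^bsub>M\<^esub> x = \<zero>\<^bsub>M\<^esub>"
  then have "carrier M = pow_torsion R I M (Suc 0)" using I by (auto simp: pow_torsion_def)
  then have "carrier M = (\<Union>k. pow_torsion R I M k)" by (auto simp: pow_torsion_def)
  then show "torsion_module R I M \<and> reduced_module R I M"
    using asm by (simp add: torsion_module_iff[OF I] reduced_module_def)
qed

end

section \<open>Free modules\<close>

lemma free_module_simps:
  "u \<in> carrier (free_module R S) \<longleftrightarrow>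
    (\<forall>p. u p \<in> carrier R) \<and> finite {p. u p \<noteq> \<zero>\<^bsub>R\<^esub>} \<and> {p. u p \<noteq> \<zero>\<^bsub>R\<^esub>} \<subseteq> S"
  "\<zero>\<^bsub>free_module R S\<^esub> = (\<lambda>p. \<zero>\<^bsub>R\<^esub>)"
  "u \<oplus>\<^bsub>free_module R S\<^esub> v = (\<lambda>p. u p \<oplus>\<^bsub>R\<^esub> v p)"
  "r \<odot>\<^bsub>free_module R S\<^esub> u = (\<lambda>p. r \<otimes>\<^bsub>R\<^esub> u p)"
  by (auto simp: free_module_def)

definition free_lift ::
  "('a, 'r) ring_scheme \<Rightarrow> ('a, 'n, 'y) module_scheme \<Rightarrow> ('p \<Rightarrow> 'n) \<Rightarrow> ('p \<Rightarrow> 'a) \<Rightarrow> 'n"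
  where "free_lift R P h u = (\<Oplus>\<^bsub>P\<^esub>p\<in>{p. u p \<noteq> \<zero>\<^bsub>R\<^esub>}. u p \<odot>\<^bsub>P\<^esub> h p)"

context cring
begin

lemma free_module_add_closed:
  assumes u: "u \<in> carrier (free_module R S)" and v: "v \<in> carrier (free_module R S)"
  shows "u \<oplus>\<^bsub>free_module R S\<^esub> v \<in> carrier (free_module R S)"
proof -
  have "{p. u p \<oplus> v p \<noteq> \<zero>} \<subseteq> {p. u p \<noteq> \<zero>} \<union> {p. v p \<noteq> \<zero>}" by auto
  then show ?thesis
    using u v finite_subset[of "{p. u p \<oplus> v p \<noteq> \<zero>}" "{p. u p \<noteq> \<zero>} \<union> {p. v p \<noteq> \<zero>}"]
    by (auto simp: free_module_simps)
qed

lemma free_module_smult_closed: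
  assumes r: "r \<in> carrier R" and u: "u \<in> carrier (free_module R S)"
  shows "r \<odot>\<^bsub>free_module R S\<^esub> u \<in> carrier (free_module R S)"
proof -
  have "{p. r \<otimes> u p \<noteq> \<zero>} \<subseteq> {p. u p \<noteq> \<zero>}" using r by auto
  then show ?thesis
    using r u finite_subset[of "{p. r \<otimes> u p \<noteq> \<zero>}" "{p. u p \<noteq> \<zero>}"]
    by (auto simp: free_module_simps)
qed

lemma free_module_is_module: "module R (free_module R S)"
proof (rule moduleI[OF is_cring])
  show "abelian_group (free_module R S)"
  proof (rule abelian_groupI)
    fix u assume u: "u \<in> carrier (free_module R S)"
    show "\<exists>v\<in>carrier (free_module R S). v \<oplus>\<^bsub>free_module R S\<^esub> u = \<zero>\<^bsub>free_module R S\<^esub>"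
    proof
      show "(\<ominus> \<one>) \<odot>\<^bsub>free_module R S\<^esub> u \<in> carrier (free_module R S)"
        using u by (simp add: free_module_smult_closed)
      show "(\<ominus> \<one>) \<odot>\<^bsub>free_module R S\<^esub> u \<oplus>\<^bsub>free_module R S\<^esub> u = \<zero>\<^bsub>free_module R S\<^esub>"
        using u by (simp add: free_module_simps l_minus l_neg)
    qed
  qed (simp_all add: free_module_add_closed, simp_all add: free_module_simps add.m_ac)
qed (simp_all add: free_module_smult_closed, simp_all add: free_module_simps l_distr r_distr m_assoc)

lemma free_gen_in_carrier:
  assumes "p \<in> S" shows "free_gen R p \<in> carrier (free_module R S)"
proof -
  have "{q. free_gen R p q \<noteq> \<zero>} \<subseteq> {p}" by (auto simp: free_gen_def)
  then show ?thesis
    using assms finite_subset[of "{q. free_gen R p q \<noteq> \<zero>}" "{p}"]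
    by (auto simp: free_module_simps free_gen_def)
qed

text \<open>
Induction on a finite set containing the support: clearing one coordinate $p$ of $u$ leaves an
element supported in a smaller set, and the difference is a multiple of the basis element at $p$.
\<close>

lemma free_module_generated:
  assumes H: "submodule H R (free_module R S)" and gen: "\<And>p. p \<in> S \<Longrightarrow> free_gen R p \<in> H"
  shows "carrier (free_module R S) \<subseteq> H"
proof
  interpret F: module R "free_module R S" by (rule free_module_is_module)
  have "u \<in> H" if "finite T" "u \<in> carrier (free_module R S)" "{p. u p \<noteq> \<zero>} \<subseteq> T" for T u
    using that
  proof (induction T arbitrary: u rule: finite_induct)
    case empty
    then have "u = \<zero>\<^bsub>free_module R S\<^esub>" by (auto simp: free_module_simps)
    then show ?case using F.submodule_zero[OF H] by simp
  next
    case (insert p T)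
    have u: "\<And>q. u q \<in> carrier R" "finite {q. u q \<noteq> \<zero>}" "{q. u q \<noteq> \<zero>} \<subseteq> S"
      using insert.prems by (auto simp: free_module_simps)
    define v where "v = u(p := \<zero>)"
    have sv: "{q. v q \<noteq> \<zero>} \<subseteq> {q. u q \<noteq> \<zero>}" by (auto simp: v_def)
    have "v \<in> carrier (free_module R S)"
      using u sv finite_subset[OF sv] by (auto simp: free_module_simps v_def)
    moreover have "{q. v q \<noteq> \<zero>} \<subseteq> T" using insert.prems(2) by (auto simp: v_def)
    ultimately have v: "v \<in> H" by (rule insert.IH)
    show ?case
    proof (cases "p \<in> S")
      case True
      have "v \<oplus>\<^bsub>free_module R S\<^esub> u p \<odot>\<^bsub>free_module R S\<^esub> free_gen R p = u"
        using u(1) by (auto simp: free_module_simps v_def free_gen_def fun_eq_iff)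
      then show ?thesis
        using F.submoduleE(5)[OF H v F.submoduleE(4)[OF H u(1) gen[OF True]], of p] by simp
    next
      case False
      then have "u = v" using u(3) by (auto simp: v_def fun_eq_iff)
      then show ?thesis using v by simp
    qed
  qed
  then show "u \<in> H" if "u \<in> carrier (free_module R S)" for u
    using that by (auto simp: free_module_simps(1))
qed

text \<open>
Two elements can then be summed over the union of their supports, which makes the extension visibly
additive.
\<close>

lemma free_lift_superset:
  assumes "module R P" and h: "h \<in> S \<rightarrow> carrier P" and T: "finite T" "T \<subseteq> S"
    and u: "\<And>p. u p \<in> carrier R" "{p. u p \<noteq> \<zero>} \<subseteq> T"
  shows "free_lift R P h u = (\<Oplus>\<^bsub>P\<^esub>p\<in>T. u p \<odot>\<^bsub>P\<^esub> h p)"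
proof -
  interpret P: module R P by fact
  show ?thesis
    unfolding free_lift_def
    by (rule P.add.finprod_mono_neutral_cong_left) (use T u h in \<open>auto simp: Pi_iff subset_iff\<close>)
qed

lemma free_lift_hom:
  assumes "module R P" and h: "h \<in> S \<rightarrow> carrier P"
  shows "u \<in> carrier (free_module R S) \<Longrightarrow> free_lift R P h u \<in> carrier P"
    and "\<lbrakk>u \<in> carrier (free_module R S); v \<in> carrier (free_module R S)\<rbrakk> \<Longrightarrow>
      free_lift R P h (u \<oplus>\<^bsub>free_module R S\<^esub> v) = free_lift R P h u \<oplus>\<^bsub>P\<^esub> free_lift R P h v"
    and "\<lbrakk>r \<in> carrier R; u \<in> carrier (free_module R S)\<rbrakk> \<Longrightarrow>
      free_lift R P h (r \<odot>\<^bsub>free_module R S\<^esub> u) = r \<odot>\<^bsub>P\<^esub> free_lift R P h u"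
    and "p \<in> S \<Longrightarrow> free_lift R P h (free_gen R p) = h p"
proof -
  interpret P: module R P by fact
  note sup = free_lift_superset[OF assms]
  show "free_lift R P h u \<in> carrier P" if "u \<in> carrier (free_module R S)"
    unfolding free_lift_def
    by (rule P.finsum_closed) (use that h in \<open>auto simp: free_module_simps Pi_iff subset_iff\<close>)
  show "free_lift R P h (u \<oplus>\<^bsub>free_module R S\<^esub> v) = free_lift R P h u \<oplus>\<^bsub>P\<^esub> free_lift R P h v"
    if u: "u \<in> carrier (free_module R S)" and v: "v \<in> carrier (free_module R S)"
  proof -
    define T where "T = {p. u p \<noteq> \<zero>} \<union> {p. v p \<noteq> \<zero>}"
    have T: "finite T" "T \<subseteq> S" using u v by (auto simp: T_def free_module_simps)
    have c: "\<And>p. u p \<in> carrier R" "\<And>p. v p \<in> carrier R" using u v by (auto simp: free_module_simps)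
    have hT: "h p \<in> carrier P" if "p \<in> T" for p using h T(2) that by auto
    have "free_lift R P h (u \<oplus>\<^bsub>free_module R S\<^esub> v) = (\<Oplus>\<^bsub>P\<^esub>p\<in>T. (u p \<oplus> v p) \<odot>\<^bsub>P\<^esub> h p)"
      unfolding free_module_simps by (rule sup[OF T]) (auto simp: c T_def)
    also have "\<dots> = (\<Oplus>\<^bsub>P\<^esub>p\<in>T. u p \<odot>\<^bsub>P\<^esub> h p \<oplus>\<^bsub>P\<^esub> v p \<odot>\<^bsub>P\<^esub> h p)"
      by (rule P.finsum_cong') (auto simp: c hT P.smult_l_distr)
    also have "\<dots> = (\<Oplus>\<^bsub>P\<^esub>p\<in>T. u p \<odot>\<^bsub>P\<^esub> h p) \<oplus>\<^bsub>P\<^esub> (\<Oplus>\<^bsub>P\<^esub>p\<in>T. v p \<odot>\<^bsub>P\<^esub> h p)"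
      by (rule P.finsum_addf) (auto simp: c hT)
    also have "\<dots> = free_lift R P h u \<oplus>\<^bsub>P\<^esub> free_lift R P h v"
      using sup[OF T, of u] sup[OF T, of v] c by (simp add: T_def)
    finally show ?thesis .
  qed
  show "free_lift R P h (r \<odot>\<^bsub>free_module R S\<^esub> u) = r \<odot>\<^bsub>P\<^esub> free_lift R P h u"
    if r: "r \<in> carrier R" and u: "u \<in> carrier (free_module R S)"
  proof -
    define T where "T = {p. u p \<noteq> \<zero>}"
    have T: "finite T" "T \<subseteq> S" using u by (auto simp: T_def free_module_simps)
    have c: "\<And>p. u p \<in> carrier R" using u by (auto simp: free_module_simps)
    have hT: "h p \<in> carrier P" if "p \<in> T" for p using h T(2) that by auto
    have "free_lift R P h (r \<odot>\<^bsub>free_module R S\<^esub> u) = (\<Oplus>\<^bsub>P\<^esub>p\<in>T. (r \<otimes> u p) \<odot>\<^bsub>P\<^esub> h p)"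
      unfolding free_module_simps by (rule sup[OF T]) (auto simp: c r T_def)
    also have "\<dots> = (\<Oplus>\<^bsub>P\<^esub>p\<in>T. r \<odot>\<^bsub>P\<^esub> (u p \<odot>\<^bsub>P\<^esub> h p))"
      by (rule P.finsum_cong') (auto simp: c r hT P.smult_assoc1)
    also have "\<dots> = r \<odot>\<^bsub>P\<^esub> (\<Oplus>\<^bsub>P\<^esub>p\<in>T. u p \<odot>\<^bsub>P\<^esub> h p)"
      by (rule P.finsum_smult_ldistr[symmetric]) (auto simp: T c r hT)
    finally show ?thesis by (simp add: free_lift_def T_def)
  qed
  show "free_lift R P h (free_gen R p) = h p" if p: "p \<in> S"
  proof -
    have hp: "h p \<in> carrier P" using h p by auto
    have "free_lift R P h (free_gen R p) = (\<Oplus>\<^bsub>P\<^esub>q\<in>{p}. free_gen R p q \<odot>\<^bsub>P\<^esub> h q)"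
      by (rule sup) (use p in \<open>auto simp: free_gen_def\<close>)
    also have "\<dots> = h p" using hp by (simp add: free_gen_def P.finsum_insert)
    finally show ?thesis .
  qed
qed

end

section \<open>Tensor products\<close>

definition pure_tensor ::
  "('a, 'r) ring_scheme \<Rightarrow> ('a, 'm, 'x) module_scheme \<Rightarrow> ('a, 'n, 'y) module_scheme
    \<Rightarrow> 'm \<Rightarrow> 'n \<Rightarrow> ('m \<times> 'n \<Rightarrow> 'a) set"
  where "pure_tensor R M N x y =
    tensor_ker R M N +>\<^bsub>free_module R (carrier M \<times> carrier N)\<^esub> free_gen R (x, y)"

text \<open>
The two modules are fixed together so that the free module on their product, its submodule of
relations and the tensor product are available as interpreted modules.
\<close>

locale two_modules = M: module R M + N: module R N
  for R (structure) and M :: "('a, 'm, 'x) module_scheme" and N :: "('a, 'n, 'y) module_scheme"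
begin

abbreviation "F \<equiv> free_module R (carrier M \<times> carrier N)"
abbreviation "K \<equiv> tensor_ker R M N"
abbreviation "gen x y \<equiv> free_gen R (x, y)"

sublocale F: module R F by (rule M.free_module_is_module)

lemma gen_closed [simp]: "\<lbrakk>x \<in> carrier M; y \<in> carrier N\<rbrakk> \<Longrightarrow> gen x y \<in> carrier F"
  by (rule M.free_gen_in_carrier) simp

lemma tensor_rels_subset: "tensor_rels R M N \<subseteq> carrier F"
  by (auto simp: tensor_rels_def Let_def simp del: F.minus_closed intro!: F.minus_closed)

lemma tensor_ker_submodule: "submodule K R F"
  unfolding tensor_ker_def by (rule F.submodule_span_submodule[OF tensor_rels_subset])

lemma tensor_rels_in_ker:
  shows "\<lbrakk>x \<in> carrier M; x' \<in> carrier M; y \<in> carrier N\<rbrakk> \<Longrightarrow>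
      gen (x \<oplus>\<^bsub>M\<^esub> x') y \<ominus>\<^bsub>F\<^esub> (gen x y \<oplus>\<^bsub>F\<^esub> gen x' y) \<in> K"
    and "\<lbrakk>x \<in> carrier M; y \<in> carrier N; y' \<in> carrier N\<rbrakk> \<Longrightarrow>
      gen x (y \<oplus>\<^bsub>N\<^esub> y') \<ominus>\<^bsub>F\<^esub> (gen x y \<oplus>\<^bsub>F\<^esub> gen x y') \<in> K"
    and "\<lbrakk>r \<in> carrier R; x \<in> carrier M; y \<in> carrier N\<rbrakk> \<Longrightarrow>
      gen (r \<odot>\<^bsub>M\<^esub> x) y \<ominus>\<^bsub>F\<^esub> (r \<odot>\<^bsub>F\<^esub> gen x y) \<in> K"
    and "\<lbrakk>r \<in> carrier R; x \<in> carrier M; y \<in> carrier N\<rbrakk> \<Longrightarrow>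
      gen x (r \<odot>\<^bsub>N\<^esub> y) \<ominus>\<^bsub>F\<^esub> (r \<odot>\<^bsub>F\<^esub> gen x y) \<in> K"
  unfolding tensor_ker_def
  by (rule subsetD[OF submodule_span_superset], simp only: tensor_rels_def Let_def, blast)+

text \<open>
The map $h$ is required to be bilinear only modulo a submodule $H$. With $H = 0$ this gives the
universal property of the tensor product; with $H$ the submodule of relations of a second tensor
product it gives the well-definedness of $f \otimes g$.
\<close>

lemma free_lift_tensor_ker:
  assumes "module R P" and H: "submodule H R P"
    and h: "\<And>x y. \<lbrakk>x \<in> carrier M; y \<in> carrier N\<rbrakk> \<Longrightarrow> h (x, y) \<in> carrier P"
    and add1: "\<And>x x' y. \<lbrakk>x \<in> carrier M; x' \<in> carrier M; y \<in> carrier N\<rbrakk> \<Longrightarrow>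
      h (x \<oplus>\<^bsub>M\<^esub> x', y) \<ominus>\<^bsub>P\<^esub> (h (x, y) \<oplus>\<^bsub>P\<^esub> h (x', y)) \<in> H"
    and add2: "\<And>x y y'. \<lbrakk>x \<in> carrier M; y \<in> carrier N; y' \<in> carrier N\<rbrakk> \<Longrightarrow>
      h (x, y \<oplus>\<^bsub>N\<^esub> y') \<ominus>\<^bsub>P\<^esub> (h (x, y) \<oplus>\<^bsub>P\<^esub> h (x, y')) \<in> H"
    and smult1: "\<And>r x y. \<lbrakk>r \<in> carrier R; x \<in> carrier M; y \<in> carrier N\<rbrakk> \<Longrightarrow>
      h (r \<odot>\<^bsub>M\<^esub> x, y) \<ominus>\<^bsub>P\<^esub> (r \<odot>\<^bsub>P\<^esub> h (x, y)) \<in> H"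
    and smult2: "\<And>r x y. \<lbrakk>r \<in> carrier R; x \<in> carrier M; y \<in> carrier N\<rbrakk> \<Longrightarrow>
      h (x, r \<odot>\<^bsub>N\<^esub> y) \<ominus>\<^bsub>P\<^esub> (r \<odot>\<^bsub>P\<^esub> h (x, y)) \<in> H"
    and u: "u \<in> K"
  shows "free_lift R P h u \<in> H"
proof -
  interpret P: module R P by fact
  have hS: "h \<in> carrier M \<times> carrier N \<rightarrow> carrier P" using h by auto
  note L = M.free_lift_hom[OF \<open>module R P\<close> hS]
  have gen: "free_lift R P h (gen x y) = h (x, y)" if "x \<in> carrier M" "y \<in> carrier N" for x y
    using L(4) that by simp
  have diff: "free_lift R P h (v \<ominus>\<^bsub>F\<^esub> w) = free_lift R P h v \<ominus>\<^bsub>P\<^esub> free_lift R P h w"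
    if "v \<in> carrier F" "w \<in> carrier F" for v w
  proof -
    have "\<ominus>\<^bsub>F\<^esub> w = (\<ominus> \<one>) \<odot>\<^bsub>F\<^esub> w" using that by (simp add: F.smult_l_minus)
    then show ?thesis
      using that L(1) by (simp add: a_minus_def L(2,3) P.smult_l_minus)
  qed
  have sub: "submodule {v \<in> carrier F. free_lift R P h v \<in> H} R F"
    by (rule F.submodule_vimage[OF \<open>module R P\<close> H]) (rule L; assumption)+
  have "tensor_rels R M N \<subseteq> {v \<in> carrier F. free_lift R P h v \<in> H}"
    using add1 add2 smult1 smult2
    by (auto simp: tensor_rels_def Let_def diff L(2,3) gen)
  then have "K \<subseteq> {v \<in> carrier F. free_lift R P h v \<in> H}"
    unfolding tensor_ker_def by (rule F.submodule_span_least[OF sub])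
  then show ?thesis using u by blast
qed

sublocale T: module R "tensor_module R M N"
  unfolding tensor_module_def by (rule F.quot_module_is_module[OF tensor_ker_submodule])

lemma pure_tensor_closed [simp]:
  "\<lbrakk>x \<in> carrier M; y \<in> carrier N\<rbrakk> \<Longrightarrow> pure_tensor R M N x y \<in> carrier (tensor_module R M N)"
  by (simp add: pure_tensor_def tensor_module_def carrier_quot_module)

lemma pure_tensor_bilinear:
  shows "\<lbrakk>x \<in> carrier M; x' \<in> carrier M; y \<in> carrier N\<rbrakk> \<Longrightarrow> pure_tensor R M N (x \<oplus>\<^bsub>M\<^esub> x') y =
      pure_tensor R M N x y \<oplus>\<^bsub>tensor_module R M N\<^esub> pure_tensor R M N x' y"
    and "\<lbrakk>x \<in> carrier M; y \<in> carrier N; y' \<in> carrier N\<rbrakk> \<Longrightarrow> pure_tensor R M N x (y \<oplus>\<^bsub>N\<^esub> y') =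
      pure_tensor R M N x y \<oplus>\<^bsub>tensor_module R M N\<^esub> pure_tensor R M N x y'"
    and "\<lbrakk>r \<in> carrier R; x \<in> carrier M; y \<in> carrier N\<rbrakk> \<Longrightarrow> pure_tensor R M N (r \<odot>\<^bsub>M\<^esub> x) y =
      r \<odot>\<^bsub>tensor_module R M N\<^esub> pure_tensor R M N x y"
    and "\<lbrakk>r \<in> carrier R; x \<in> carrier M; y \<in> carrier N\<rbrakk> \<Longrightarrow> pure_tensor R M N x (r \<odot>\<^bsub>N\<^esub> y) =
      r \<odot>\<^bsub>tensor_module R M N\<^esub> pure_tensor R M N x y"
  using tensor_rels_in_ker
  by (simp_all add: pure_tensor_def tensor_module_def F.add_quot_module[OF tensor_ker_submodule]
      F.smult_quot_module[OF tensor_ker_submodule] F.coset_eq_iff[OF tensor_ker_submodule])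

lemma tensor_module_generated:
  assumes H: "submodule H R (tensor_module R M N)"
    and gen: "\<And>x y. \<lbrakk>x \<in> carrier M; y \<in> carrier N\<rbrakk> \<Longrightarrow> pure_tensor R M N x y \<in> H"
  shows "carrier (tensor_module R M N) \<subseteq> H"
proof -
  have "submodule {u \<in> carrier F. K +>\<^bsub>F\<^esub> u \<in> H} R F"
    by (rule F.submodule_vimage[OF T.module_axioms H])
      (simp_all add: tensor_module_def carrier_quot_module F.add_quot_module[OF tensor_ker_submodule]
      F.smult_quot_module[OF tensor_ker_submodule])
  then have "carrier F \<subseteq> {u \<in> carrier F. K +>\<^bsub>F\<^esub> u \<in> H}"
    by (rule M.free_module_generated) (use gen in \<open>auto simp: pure_tensor_def\<close>)
  then show ?thesis by (auto simp: tensor_module_def carrier_quot_module)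
qed

lemma tensor_lift:
  assumes "module R P"
    and h: "\<And>x y. \<lbrakk>x \<in> carrier M; y \<in> carrier N\<rbrakk> \<Longrightarrow> h x y \<in> carrier P"
    and add1: "\<And>x x' y. \<lbrakk>x \<in> carrier M; x' \<in> carrier M; y \<in> carrier N\<rbrakk> \<Longrightarrow>
      h (x \<oplus>\<^bsub>M\<^esub> x') y = h x y \<oplus>\<^bsub>P\<^esub> h x' y"
    and add2: "\<And>x y y'. \<lbrakk>x \<in> carrier M; y \<in> carrier N; y' \<in> carrier N\<rbrakk> \<Longrightarrow>
      h x (y \<oplus>\<^bsub>N\<^esub> y') = h x y \<oplus>\<^bsub>P\<^esub> h x y'"
    and smult1: "\<And>r x y. \<lbrakk>r \<in> carrier R; x \<in> carrier M; y \<in> carrier N\<rbrakk> \<Longrightarrow>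
      h (r \<odot>\<^bsub>M\<^esub> x) y = r \<odot>\<^bsub>P\<^esub> h x y"
    and smult2: "\<And>r x y. \<lbrakk>r \<in> carrier R; x \<in> carrier M; y \<in> carrier N\<rbrakk> \<Longrightarrow>
      h x (r \<odot>\<^bsub>N\<^esub> y) = r \<odot>\<^bsub>P\<^esub> h x y"
  shows "\<exists>f\<in>mod_hom R (tensor_module R M N) P.
    \<forall>x\<in>carrier M. \<forall>y\<in>carrier N. f (pure_tensor R M N x y) = h x y"
proof -
  interpret P: module R P by fact
  have hS: "(\<lambda>(x, y). h x y) \<in> carrier M \<times> carrier N \<rightarrow> carrier P" using h by auto
  note L = M.free_lift_hom[OF \<open>module R P\<close> hS]
  have z: "a \<ominus>\<^bsub>P\<^esub> a = \<zero>\<^bsub>P\<^esub>" if "a \<in> carrier P" for a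
    using that by (simp add: a_minus_def P.r_neg)
  have ker: "free_lift R P (\<lambda>(x, y). h x y) u = \<zero>\<^bsub>P\<^esub>" if "u \<in> K" for u
  proof -
    have "free_lift R P (\<lambda>(x, y). h x y) u \<in> {\<zero>\<^bsub>P\<^esub>}"
      by (rule free_lift_tensor_ker[OF \<open>module R P\<close> P.zero_submodule])
        (use that in \<open>simp_all add: h add1 add2 smult1 smult2 z\<close>)
    then show ?thesis by simp
  qed
  obtain f where f: "f \<in> mod_hom R (quot_module F K) P"
    and fK: "\<forall>u\<in>carrier F. f (K +>\<^bsub>F\<^esub> u) = free_lift R P (\<lambda>(x, y). h x y) u"
    using F.quot_module_lift[OF tensor_ker_submodule \<open>module R P\<close> L(1-3) ker] by blast
  have "f (pure_tensor R M N x y) = h x y" if "x \<in> carrier M" "y \<in> carrier N" for x y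
    using fK that L(4)[of "(x, y)"] by (simp add: pure_tensor_def)
  then show ?thesis using f unfolding tensor_module_def by blast
qed

text \<open>
The basis element at $(x, y)$ goes to the one at $(f x, g y)$, and this assignment is bilinear modulo
the relations of the target; hence any representative of the class $x \otimes y$ may be used to
compute its image.
\<close>

lemma tensor_map_pure:
  assumes M': "module R M'" and N': "module R N'"
    and f: "f \<in> mod_hom R M M'" and g: "g \<in> mod_hom R N N'"
    and x: "x \<in> carrier M" and y: "y \<in> carrier N"
  shows "tensor_map R M N M' N' f g (pure_tensor R M N x y) = pure_tensor R M' N' (f x) (g y)"
proof -
  interpret B: two_modules R M' N' using M' N' by (rule two_modules.intro)
  note f' = mod_homD[OF f] and g' = mod_homD[OF g]
  define h where "h = (\<lambda>p. free_gen R (f (fst p), g (snd p)))"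
  have hS: "h \<in> carrier M \<times> carrier N \<rightarrow> carrier B.F" using f' g' by (auto simp: h_def)
  note L = M.free_lift_hom[OF B.F.module_axioms hS]
  have ker: "free_lift R B.F h u \<in> B.K" if "u \<in> K" for u
    by (rule free_lift_tensor_ker[OF B.F.module_axioms B.tensor_ker_submodule _ _ _ _ _ that])
      (simp_all add: h_def f' g' B.tensor_rels_in_ker)
  have const: "B.K +>\<^bsub>B.F\<^esub> free_lift R B.F h u = B.K +>\<^bsub>B.F\<^esub> free_lift R B.F h (gen x y)"
    if u: "u \<in> carrier F" "u \<ominus>\<^bsub>F\<^esub> gen x y \<in> K" for u
  proof -
    have e: "gen x y \<in> carrier F" using x y by simp
    have "\<ominus>\<^bsub>F\<^esub> gen x y = (\<ominus> \<one>) \<odot>\<^bsub>F\<^esub> gen x y" using e by (simp add: F.smult_l_minus)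
    then have "free_lift R B.F h (u \<ominus>\<^bsub>F\<^esub> gen x y)
        = free_lift R B.F h u \<ominus>\<^bsub>B.F\<^esub> free_lift R B.F h (gen x y)"
      using u(1) e L(1) by (simp add: a_minus_def L(2,3) B.F.smult_l_minus)
    then show ?thesis
      using ker[OF u(2)] L(1)[OF u(1)] L(1)[OF e] by (simp add: B.F.coset_eq_iff[OF B.tensor_ker_submodule])
  qed
  have "tensor_map R M N M' N' f g (pure_tensor R M N x y)
    = (\<Union>u\<in>K +>\<^bsub>F\<^esub> gen x y. B.K +>\<^bsub>B.F\<^esub> free_lift R B.F h u)"
    using pure_tensor_closed[OF x y]
    by (simp add: tensor_map_def Let_def pure_tensor_def free_lift_def h_def)
  also have "\<dots> = B.K +>\<^bsub>B.F\<^esub> free_lift R B.F h (gen x y)"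
    by (rule F.UN_coset_const[OF tensor_ker_submodule gen_closed[OF x y]]) (rule const)
  also have "\<dots> = pure_tensor R M' N' (f x) (g y)"
    using L(4)[of "(x, y)"] x y by (simp add: h_def pure_tensor_def)
  finally show ?thesis .
qed

end

section \<open>Completion\<close>

text \<open>
The element $1 \otimes x$ of $R/I^k \otimes M$, with $k$ as the last argument, so that
\<open>unit_tensor R I M x\<close> is the image of $x$ under the canonical map $M \to \Lambda_I(M)$.
\<close>

definition unit_tensor ::
  "('a, 'r) ring_scheme \<Rightarrow> 'a set \<Rightarrow> ('a, 'm, 'x) module_scheme \<Rightarrow> 'm \<Rightarrow> nat \<Rightarrow> ('a set \<times> 'm \<Rightarrow> 'a) set"
  where "unit_tensor R I M x k = pure_tensor R (ring_mod_pow R I k) M (residue R I k \<one>\<^bsub>R\<^esub>) x"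

context module
begin

lemma ring_mod_pow_two_modules: "ideal I R \<Longrightarrow> two_modules R (ring_mod_pow R I k) M"
  by (intro two_modules.intro ring_mod_pow_module module_axioms)

text \<open>
If $r M \subseteq I^k M$ then $r (Y \otimes x) = Y \otimes r x$ is a sum of terms
$Y \otimes t y = t Y \otimes y$ with $t \in I^k$, and $t Y = 0$ in $R/I^k$.
\<close>

lemma tensor_ring_mod_pow_killed:
  assumes I: "ideal I R" and r: "r \<in> carrier R"
    and div: "\<And>x. x \<in> carrier M \<Longrightarrow> r \<odot>\<^bsub>M\<^esub> x \<in> ideal_smult R (ideal_pow R I k) M"
    and X: "X \<in> carrier (tensor_module R (ring_mod_pow R I k) M)"
  shows "r \<odot>\<^bsub>tensor_module R (ring_mod_pow R I k) M\<^esub> X = \<zero>\<^bsub>tensor_module R (ring_mod_pow R I k) M\<^esub>"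
proof -
  interpret B: two_modules R "ring_mod_pow R I k" M by (rule ring_mod_pow_two_modules[OF I])
  let ?Q = "ring_mod_pow R I k" and ?T = "tensor_module R (ring_mod_pow R I k) M"
  have pz: "pure_tensor R ?Q M \<zero>\<^bsub>?Q\<^esub> y = \<zero>\<^bsub>?T\<^esub>" if y: "y \<in> carrier M" for y
    using B.pure_tensor_bilinear(3)[OF R.zero_closed B.M.zero_closed y] y by simp
  have kill: "ideal_smult R (ideal_pow R I k) M \<subseteq> {y \<in> carrier M. pure_tensor R ?Q M Y y \<in> {\<zero>\<^bsub>?T\<^esub>}}"
    if Y: "Y \<in> carrier ?Q" for Y
  proof (rule ideal_smult_least)
    show "submodule {y \<in> carrier M. pure_tensor R ?Q M Y y \<in> {\<zero>\<^bsub>?T\<^esub>}} R M"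
      by (rule submodule_vimage[OF B.T.module_axioms B.T.zero_submodule])
        (use Y in \<open>simp_all add: B.pure_tensor_bilinear\<close>)
    fix t y assume t: "t \<in> ideal_pow R I k" and y: "y \<in> carrier M"
    obtain s where s: "s \<in> carrier R" "Y = residue R I k s"
      using Y by (auto simp: carrier_ring_mod_pow)
    interpret Ik: ideal "ideal_pow R I k" R using I by (rule ideal_pow_ideal)
    have tR: "t \<in> carrier R" using t by (rule Ik.Icarr)
    have "t \<odot>\<^bsub>?Q\<^esub> Y = \<zero>\<^bsub>?Q\<^esub>"
      using s t tR by (simp add: smult_residue[OF I] residue_eq_zero[OF I] Ik.I_r_closed)
    then have "pure_tensor R ?Q M Y (t \<odot>\<^bsub>M\<^esub> y) = \<zero>\<^bsub>?T\<^esub>"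
      using B.pure_tensor_bilinear(3,4)[OF tR Y y] pz[OF y] by simp
    then show "t \<odot>\<^bsub>M\<^esub> y \<in> {y \<in> carrier M. pure_tensor R ?Q M Y y \<in> {\<zero>\<^bsub>?T\<^esub>}}"
      using tR y by simp
  qed
  have "carrier ?T \<subseteq> {X \<in> carrier ?T. r \<odot>\<^bsub>?T\<^esub> X \<in> {\<zero>\<^bsub>?T\<^esub>}}"
  proof (rule B.tensor_module_generated)
    show "submodule {X \<in> carrier ?T. r \<odot>\<^bsub>?T\<^esub> X \<in> {\<zero>\<^bsub>?T\<^esub>}} R ?T"
      by (rule B.T.submodule_vimage[OF B.T.module_axioms B.T.zero_submodule])
        (use r in \<open>simp_all add: B.T.smult_r_distr B.T.smult_assoc1[symmetric] R.m_comm\<close>)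
    show "pure_tensor R ?Q M Y y \<in> {X \<in> carrier ?T. r \<odot>\<^bsub>?T\<^esub> X \<in> {\<zero>\<^bsub>?T\<^esub>}}"
      if "Y \<in> carrier ?Q" "y \<in> carrier M" for Y y
      using subsetD[OF kill[OF that(1)] div[OF that(2)]] B.pure_tensor_bilinear(4)[OF r that] that
      by simp
  qed
  then show ?thesis using X by blast
qed

text \<open>
$I M = I^2 M = I (I M) \subseteq I (I^k M) \subseteq I^{k+1} M$, by induction on $k$.
\<close>

lemma coreduced_ideal_smult_subset:
  assumes I: "ideal I R" and co: "coreduced_module R I M"
  shows "ideal_smult R I M \<subseteq> ideal_smult R (ideal_pow R I k) M"
proof (induction k)
  case 0
  have "x \<in> ideal_smult R (carrier R) M" if "x \<in> carrier M" for x
    using smult_in_ideal_smult[OF R.one_closed that] that by simp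
  moreover have "ideal_smult R I M \<subseteq> carrier M"
    by (intro submoduleE(1) ideal_smult_submodule subsetI ideal.Icarr[OF I])
  ultimately show ?case by auto
next
  case (Suc k)
  interpret I: ideal I R by fact
  have sub: "submodule (ideal_smult R (ideal_pow R I (Suc k)) M) R M"
    by (intro ideal_smult_submodule ideal_pow_subset_carrier I)
  have step: "a \<odot>\<^bsub>M\<^esub> y \<in> ideal_smult R (ideal_pow R I (Suc k)) M"
    if a: "a \<in> I" and y: "y \<in> ideal_smult R (ideal_pow R I k) M" for a y
  proof -
    have aR: "a \<in> carrier R" using a by (rule I.Icarr)
    have "ideal_smult R (ideal_pow R I k) M
        \<subseteq> {y \<in> carrier M. a \<odot>\<^bsub>M\<^esub> y \<in> ideal_smult R (ideal_pow R I (Suc k)) M}"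
    proof (rule ideal_smult_least)
      show "submodule {y \<in> carrier M. a \<odot>\<^bsub>M\<^esub> y \<in> ideal_smult R (ideal_pow R I (Suc k)) M} R M"
        by (rule submodule_vimage[OF module_axioms sub])
          (use aR in \<open>simp_all add: smult_r_distr smult_assoc1[symmetric] R.m_comm\<close>)
      fix s x assume s: "s \<in> ideal_pow R I k" and x: "x \<in> carrier M"
      have sR: "s \<in> carrier R" using s ideal_pow_subset_carrier[OF I] by blast
      \<comment> \<open>The new factor stands on the right because \<open>ideal_pow_Suc\<close> multiplies by the ideal from the right.\<close>
      have "s \<otimes> a \<in> ideal_pow R I (Suc k)" using s a by (simp add: ideal_pow_Suc ideal_prod.prod)
      then have "(s \<otimes> a) \<odot>\<^bsub>M\<^esub> x \<in> ideal_smult R (ideal_pow R I (Suc k)) M"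
        using x by (rule smult_in_ideal_smult)
      then show "s \<odot>\<^bsub>M\<^esub> x \<in> {y \<in> carrier M. a \<odot>\<^bsub>M\<^esub> y \<in> ideal_smult R (ideal_pow R I (Suc k)) M}"
        using aR sR x by (simp add: smult_assoc1[symmetric] R.m_comm)
    qed
    then show ?thesis using y by blast
  qed
  have "ideal_smult R I M = ideal_smult R (ideal_pow R I 2) M"
    using co by (simp add: coreduced_module_def)
  also have "\<dots> \<subseteq> ideal_smult R (ideal_pow R I (Suc k)) M"
  proof (rule ideal_smult_least[OF sub])
    fix t x assume t: "t \<in> ideal_pow R I 2" and x: "x \<in> carrier M"
    show "t \<odot>\<^bsub>M\<^esub> x \<in> ideal_smult R (ideal_pow R I (Suc k)) M"
    proof (rule ideal_prod_smult_mem[OF sub I.a_subset I.a_subset x])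
      show "t \<in> I \<cdot>\<^bsub>R\<^esub> I" using t I by (simp add: ideal_pow_2)
      show "a \<odot>\<^bsub>M\<^esub> (b \<odot>\<^bsub>M\<^esub> x) \<in> ideal_smult R (ideal_pow R I (Suc k)) M"
        if "a \<in> I" "b \<in> I" for a b
        using step[OF that(1)] Suc.IH smult_in_ideal_smult[OF that(2) x] by blast
    qed
  qed
  finally show ?case .
qed

text \<open>
For a coreduced module $I$ kills every $R/I^k \otimes M$, hence every compatible family and all of
$\Lambda_I(M)$. Any isomorphism from $M$ carries this back to $M$.
\<close>

lemma complete_coreduced_imp_killed:
  assumes I: "ideal I R" and com: "complete_module R I M" and co: "coreduced_module R I M"
    and r: "r \<in> I" and x: "x \<in> carrier M"
  shows "r \<odot>\<^bsub>M\<^esub> x = \<zero>\<^bsub>M\<^esub>"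
proof -
  have rR: "r \<in> carrier R" using ideal.Icarr[OF I r] .
  obtain h where h: "h \<in> mod_hom R M (Lambda R I M)"
    and bij: "bij_betw h (carrier M) (carrier (Lambda R I M))"
    using com by (auto simp: complete_module_def mod_iso_def)
  have hx: "h x k \<in> carrier (tensor_module R (ring_mod_pow R I k) M)" for k
    using mod_homD(1)[OF h x] by (simp add: Lambda_def invlim_def)
  have "h (r \<odot>\<^bsub>M\<^esub> x) k = h (\<zero> \<odot>\<^bsub>M\<^esub> x) k" for k
  proof -
    interpret B: two_modules R "ring_mod_pow R I k" M by (rule ring_mod_pow_two_modules[OF I])
    have "r \<odot>\<^bsub>tensor_module R (ring_mod_pow R I k) M\<^esub> h x k
        = \<zero>\<^bsub>tensor_module R (ring_mod_pow R I k) M\<^esub>"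
      by (rule tensor_ring_mod_pow_killed[OF I rR _ hx])
        (use coreduced_ideal_smult_subset[OF I co] smult_in_ideal_smult[OF r] in blast)
    moreover have "\<zero> \<odot>\<^bsub>tensor_module R (ring_mod_pow R I k) M\<^esub> h x k
        = \<zero>\<^bsub>tensor_module R (ring_mod_pow R I k) M\<^esub>"
      by (rule B.T.smult_l_null[OF hx])
    ultimately show ?thesis
      using mod_homD(3)[OF h rR x] mod_homD(3)[OF h R.zero_closed x]
      by (simp add: Lambda_def invlim_def)
  qed
  then have "h (r \<odot>\<^bsub>M\<^esub> x) = h (\<zero> \<odot>\<^bsub>M\<^esub> x)" by (rule ext)
  then have "r \<odot>\<^bsub>M\<^esub> x = \<zero> \<odot>\<^bsub>M\<^esub> x"
    using bij rR x by (meson R.zero_closed bij_betw_imp_inj_on inj_onD smult_closed)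
  then show ?thesis using x by simp
qed

text \<open>
The elements $1 \otimes x$ form a submodule, and it contains all pure tensors because
$r \otimes x = 1 \otimes r x$.
\<close>

lemma tensor_ring_mod_pow_pure:
  assumes I: "ideal I R" and X: "X \<in> carrier (tensor_module R (ring_mod_pow R I k) M)"
  shows "\<exists>x\<in>carrier M. X = unit_tensor R I M x k"
proof -
  interpret B: two_modules R "ring_mod_pow R I k" M by (rule ring_mod_pow_two_modules[OF I])
  let ?Q = "ring_mod_pow R I k" and ?T = "tensor_module R (ring_mod_pow R I k) M"
  define u where "u x = pure_tensor R ?Q M (residue R I k \<one>) x" for x
  have u: "u x \<in> carrier ?T" if "x \<in> carrier M" for x
    using that by (simp add: u_def)
  have u_add: "u (x \<oplus>\<^bsub>M\<^esub> y) = u x \<oplus>\<^bsub>?T\<^esub> u y" if "x \<in> carrier M" "y \<in> carrier M" for x y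
    using that by (simp add: u_def B.pure_tensor_bilinear)
  have u_smult: "u (r \<odot>\<^bsub>M\<^esub> x) = r \<odot>\<^bsub>?T\<^esub> u x" if "r \<in> carrier R" "x \<in> carrier M" for r x
    using that by (simp add: u_def B.pure_tensor_bilinear)
  have sub: "submodule (u ` carrier M) R ?T"
  proof (rule B.T.submoduleI)
    have "u \<zero>\<^bsub>M\<^esub> = \<zero>\<^bsub>?T\<^esub>"
      using u_smult[OF R.zero_closed M.zero_closed] u[OF M.zero_closed] by simp
    then show "\<zero>\<^bsub>?T\<^esub> \<in> u ` carrier M"
      using imageI[OF M.zero_closed, of u] by simp
  next
    fix X assume "X \<in> u ` carrier M"
    then obtain x where x: "x \<in> carrier M" "X = u x" by (rule imageE) simp
    have "(\<ominus> \<one>) \<odot>\<^bsub>M\<^esub> x \<in> carrier M" using x by simp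
    moreover have "u ((\<ominus> \<one>) \<odot>\<^bsub>M\<^esub> x) = \<ominus>\<^bsub>?T\<^esub> X"
      using u_smult[of "\<ominus> \<one>" x] u[of x] x by (simp add: B.T.smult_l_minus)
    ultimately show "\<ominus>\<^bsub>?T\<^esub> X \<in> u ` carrier M"
      using imageI[of "(\<ominus> \<one>) \<odot>\<^bsub>M\<^esub> x" "carrier M" u] by simp
  next
    fix X Y assume "X \<in> u ` carrier M" "Y \<in> u ` carrier M"
    then show "X \<oplus>\<^bsub>?T\<^esub> Y \<in> u ` carrier M" using u_add[symmetric] by auto
  next
    fix r X assume "r \<in> carrier R" "X \<in> u ` carrier M"
    then show "r \<odot>\<^bsub>?T\<^esub> X \<in> u ` carrier M" using u_smult[symmetric] by auto
  qed (use u in auto)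
  have "carrier ?T \<subseteq> u ` carrier M"
  proof (rule B.tensor_module_generated[OF sub])
    fix Y x assume "Y \<in> carrier ?Q" and x: "x \<in> carrier M"
    then obtain r where r: "r \<in> carrier R" "Y = r \<odot>\<^bsub>?Q\<^esub> residue R I k \<one>"
      by (auto simp: carrier_ring_mod_pow residue_eq_smult_one[OF I, symmetric])
    then have "pure_tensor R ?Q M Y x = u (r \<odot>\<^bsub>M\<^esub> x)"
      using x by (simp add: u_def B.pure_tensor_bilinear)
    then show "pure_tensor R ?Q M Y x \<in> u ` carrier M" using r x by blast
  qed
  then show ?thesis using X by (auto simp: u_def unit_tensor_def)
qed

lemma tensor_map_unit_tensor:
  assumes I: "ideal I R" and ij: "i \<le> j" and x: "x \<in> carrier M"
  shows "tensor_map R (ring_mod_pow R I j) M (ring_mod_pow R I i) M (pow_proj R I j i)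
    (\<lambda>m\<in>carrier M. m) (unit_tensor R I M x j) = unit_tensor R I M x i"
proof -
  interpret B: two_modules R "ring_mod_pow R I j" M by (rule ring_mod_pow_two_modules[OF I])
  have "(\<lambda>m\<in>carrier M. m) \<in> mod_hom R M M"
    by (rule mod_hom_restrictI[OF module_axioms]) simp_all
  from B.tensor_map_pure[OF ring_mod_pow_module[OF I] module_axioms pow_proj_hom[OF I ij] this
      residue_in_carrier[OF R.one_closed] x]
  show ?thesis using x by (simp add: unit_tensor_def pow_proj_residue[OF I ij])
qed

text \<open>
If $I^k$ kills $M$, then $M$ is a module over $R/I^k$, and the action $R/I^k \otimes M \to M$ sends
$1 \otimes x$ back to $x$. For each $x$ the action on $x$ is the homomorphism $R/I^k \to M$ with
value $x$ at the class of $1$.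
\<close>

lemma unit_tensor_inj:
  assumes I: "ideal I R" and kill: "pow_torsion R I M k = carrier M"
    and x: "x \<in> carrier M" and y: "y \<in> carrier M"
    and eq: "unit_tensor R I M x k = unit_tensor R I M y k"
  shows "x = y"
proof -
  let ?Q = "ring_mod_pow R I k"
  interpret B: two_modules R ?Q M by (rule ring_mod_pow_two_modules[OF I])
  have "\<forall>x\<in>carrier M. \<exists>f. f \<in> mod_hom R ?Q M \<and> (\<forall>r\<in>carrier R. f (residue R I k r) = r \<odot>\<^bsub>M\<^esub> x)"
    using Hom_with_value[OF I, of _ k] kill by blast
  then obtain \<phi> where \<phi>: "\<And>x r. \<lbrakk>x \<in> carrier M; r \<in> carrier R\<rbrakk> \<Longrightarrow> \<phi> x (residue R I k r) = r \<odot>\<^bsub>M\<^esub> x"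
    by metis
  have "\<exists>f\<in>mod_hom R (tensor_module R ?Q M) M.
      \<forall>X\<in>carrier ?Q. \<forall>x\<in>carrier M. f (pure_tensor R ?Q M X x) = \<phi> x X"
    by (rule B.tensor_lift[OF module_axioms])
      (auto simp: carrier_ring_mod_pow \<phi> add_residue[OF I] smult_residue[OF I]
        smult_l_distr smult_r_distr smult_assoc1[symmetric] R.m_comm)
  then obtain f where f: "\<forall>X\<in>carrier ?Q. \<forall>x\<in>carrier M. f (pure_tensor R ?Q M X x) = \<phi> x X"
    by blast
  have "f (unit_tensor R I M x k) = x" if "x \<in> carrier M" for x
    using that f by (simp add: unit_tensor_def \<phi>)
  then show ?thesis using eq x y by metis
qed

text \<open>
When $I M = 0$ the canonical map $M \to \Lambda_I(M)$ is an isomorphism. Injectivity is decided at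
the stage $R/I$. For surjectivity, write the member at stage $k$ of a compatible family as
$1 \otimes x_k$; for $k \ge 1$ projecting to stage $1$ gives $1 \otimes x_k = 1 \otimes x_1$ there, hence
$x_k = x_1$. At stage $0$ the tensor product vanishes, so $x_0$ is arbitrary, but compatibility with
stage $1$ still shows that the member there is $1 \otimes x_1$.
\<close>

lemma killed_imp_complete:
  assumes I: "ideal I R" and kill: "pow_torsion R I M (Suc 0) = carrier M"
  shows "complete_module R I M"
proof -
  have carL: "X \<in> carrier (Lambda R I M) \<longleftrightarrow>
      (\<forall>i. X i \<in> carrier (tensor_module R (ring_mod_pow R I i) M)) \<and>
      (\<forall>i j. i \<le> j \<longrightarrow> tensor_map R (ring_mod_pow R I j) M (ring_mod_pow R I i) M (pow_proj R I j i)
         (\<lambda>m\<in>carrier M. m) (X j) = X i)" for X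
    by (simp add: Lambda_def invlim_def)
  have closed: "unit_tensor R I M x k \<in> carrier (tensor_module R (ring_mod_pow R I k) M)"
    if "x \<in> carrier M" for x k
  proof -
    interpret B: two_modules R "ring_mod_pow R I k" M by (rule ring_mod_pow_two_modules[OF I])
    show ?thesis using that by (simp add: unit_tensor_def)
  qed
  have hom: "(\<lambda>x\<in>carrier M. unit_tensor R I M x) \<in> mod_hom R M (Lambda R I M)"
  proof (rule mod_hom_restrictI[OF module_axioms])
    show "unit_tensor R I M x \<in> carrier (Lambda R I M)" if "x \<in> carrier M" for x
      unfolding carL using closed tensor_map_unit_tensor[OF I] that by blast
    show "unit_tensor R I M (x \<oplus>\<^bsub>M\<^esub> y) = unit_tensor R I M x \<oplus>\<^bsub>Lambda R I M\<^esub> unit_tensor R I M y"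
      if "x \<in> carrier M" "y \<in> carrier M" for x y
    proof (rule ext)
      fix k
      interpret B: two_modules R "ring_mod_pow R I k" M by (rule ring_mod_pow_two_modules[OF I])
      show "unit_tensor R I M (x \<oplus>\<^bsub>M\<^esub> y) k
          = (unit_tensor R I M x \<oplus>\<^bsub>Lambda R I M\<^esub> unit_tensor R I M y) k"
        using that by (simp add: unit_tensor_def Lambda_def invlim_def B.pure_tensor_bilinear)
    qed
    show "unit_tensor R I M (r \<odot>\<^bsub>M\<^esub> x) = r \<odot>\<^bsub>Lambda R I M\<^esub> unit_tensor R I M x"
      if "r \<in> carrier R" "x \<in> carrier M" for r x
    proof (rule ext)
      fix k
      interpret B: two_modules R "ring_mod_pow R I k" M by (rule ring_mod_pow_two_modules[OF I])
      show "unit_tensor R I M (r \<odot>\<^bsub>M\<^esub> x) k = (r \<odot>\<^bsub>Lambda R I M\<^esub> unit_tensor R I M x) k"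
        using that by (simp add: unit_tensor_def Lambda_def invlim_def B.pure_tensor_bilinear)
    qed
  qed
  have surj: "\<exists>x\<in>carrier M. X = unit_tensor R I M x" if X: "X \<in> carrier (Lambda R I M)" for X
  proof -
    have comp: "tensor_map R (ring_mod_pow R I j) M (ring_mod_pow R I i) M (pow_proj R I j i)
         (\<lambda>m\<in>carrier M. m) (X j) = X i" if "i \<le> j" for i j
      using X that unfolding carL by blast
    have "\<exists>x\<in>carrier M. X k = unit_tensor R I M x k" for k
      using X tensor_ring_mod_pow_pure[OF I, of "X k" k] unfolding carL by blast
    then obtain \<xi> where \<xi>: "\<And>k. \<xi> k \<in> carrier M" "\<And>k. X k = unit_tensor R I M (\<xi> k) k"
      by metis
    have down: "X i = unit_tensor R I M (\<xi> j) i" if "i \<le> j" for i j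
      using comp[OF that] tensor_map_unit_tensor[OF I that \<xi>(1)[of j]] \<xi>(2)[of j] by simp
    have "X k = unit_tensor R I M (\<xi> (Suc 0)) k" for k
    proof (cases k)
      case 0
      then show ?thesis using down[of 0 "Suc 0"] by simp
    next
      case (Suc n)
      then have "unit_tensor R I M (\<xi> k) (Suc 0) = unit_tensor R I M (\<xi> (Suc 0)) (Suc 0)"
        using down[of "Suc 0" k] \<xi>(2)[of "Suc 0"] by simp
      then have "\<xi> k = \<xi> (Suc 0)" by (rule unit_tensor_inj[OF I kill \<xi>(1) \<xi>(1)])
      then show ?thesis using \<xi>(2)[of k] by simp
    qed
    then show ?thesis using \<xi>(1) by blast
  qed
  have "bij_betw (\<lambda>x\<in>carrier M. unit_tensor R I M x) (carrier M) (carrier (Lambda R I M))"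
    unfolding bij_betw_def
  proof
    show "inj_on (\<lambda>x\<in>carrier M. unit_tensor R I M x) (carrier M)"
      by (rule inj_onI) (auto dest: fun_cong intro: unit_tensor_inj[OF I kill])
    show "(\<lambda>x\<in>carrier M. unit_tensor R I M x) ` carrier M = carrier (Lambda R I M)"
      using mod_homD(1)[OF hom] surj by force
  qed
  then show ?thesis using hom unfolding complete_module_def mod_iso_def by blast
qed

lemma ideal_smult_eq_zero_iff:
  assumes "I \<subseteq> carrier R"
  shows "ideal_smult R I M = {\<zero>\<^bsub>M\<^esub>} \<longleftrightarrow> (\<forall>r\<in>I. \<forall>x\<in>carrier M. r \<odot>\<^bsub>M\<^esub> x = \<zero>\<^bsub>M\<^esub>)"
proof
  assume "ideal_smult R I M = {\<zero>\<^bsub>M\<^esub>}"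
  then show "\<forall>r\<in>I. \<forall>x\<in>carrier M. r \<odot>\<^bsub>M\<^esub> x = \<zero>\<^bsub>M\<^esub>" using smult_in_ideal_smult by blast
next
  assume "\<forall>r\<in>I. \<forall>x\<in>carrier M. r \<odot>\<^bsub>M\<^esub> x = \<zero>\<^bsub>M\<^esub>"
  then have "ideal_smult R I M \<subseteq> {\<zero>\<^bsub>M\<^esub>}" by (intro ideal_smult_least[OF zero_submodule]) simp
  then show "ideal_smult R I M = {\<zero>\<^bsub>M\<^esub>}"
    using submodule_zero[OF ideal_smult_submodule[OF assms]] by blast
qed

lemma complete_and_coreduced_iff:
  assumes I: "ideal I R"
  shows "complete_module R I M \<and> coreduced_module R I M
    \<longleftrightarrow> (\<forall>r\<in>I. \<forall>x\<in>carrier M. r \<odot>\<^bsub>M\<^esub> x = \<zero>\<^bsub>M\<^esub>)"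
proof
  assume "complete_module R I M \<and> coreduced_module R I M"
  then show "\<forall>r\<in>I. \<forall>x\<in>carrier M. r \<odot>\<^bsub>M\<^esub> x = \<zero>\<^bsub>M\<^esub>"
    using complete_coreduced_imp_killed[OF I] by blast
next
  assume kill: "\<forall>r\<in>I. \<forall>x\<in>carrier M. r \<odot>\<^bsub>M\<^esub> x = \<zero>\<^bsub>M\<^esub>"
  then have "complete_module R I M"
    using I by (intro killed_imp_complete) (auto simp: pow_torsion_def)
  moreover have "ideal_pow R I 2 \<subseteq> I"
    using ideal_prod_inter[OF I I] by (simp add: ideal_pow_2[OF I])
  then have "coreduced_module R I M"
    using kill ideal_smult_eq_zero_iff[OF ideal_pow_subset_carrier[OF I, of 2]]
      ideal_smult_eq_zero_iff[of I] ideal_pow_subset_carrier[OF I, of "Suc 0"] I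
    unfolding coreduced_module_def by (simp add: subset_iff)
  ultimately show "complete_module R I M \<and> coreduced_module R I M" ..
qed

end

section \<open>Complexes\<close>

text \<open>
An isomorphism with the zero complex only says that each $I M^n$ has one element. In the other
direction every condition on a family of maps into one-element modules is automatic.
\<close>

lemma (in cring) ideal_cx_iso_zero_iff:
  fixes C :: "('a, 'm) cochain"
  assumes I: "ideal I R" and C: "C \<in> complexes R"
  shows "cx_iso R (ideal_cx R I C) zero_cx
    \<longleftrightarrow> (\<forall>n. \<forall>r\<in>I. \<forall>x\<in>carrier (cx_mod C n). r \<odot>\<^bsub>cx_mod C n\<^esub> x = \<zero>\<^bsub>cx_mod C n\<^esub>)"
proof -
  have IR: "I \<subseteq> carrier R" using ideal.Icarr[OF I] by blast
  have mod: "module R (cx_mod C n)" for n using C by (simp add: complexes_def)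
  have "cx_iso R (ideal_cx R I C) zero_cx \<longleftrightarrow> (\<forall>n. ideal_smult R I (cx_mod C n) = {\<zero>\<^bsub>cx_mod C n\<^esub>})"
  proof
    assume "cx_iso R (ideal_cx R I C) zero_cx"
    then obtain f where f: "\<And>n. bij_betw (f n) (ideal_smult R I (cx_mod C n)) {()}"
      by (auto simp: cx_iso_def ideal_cx_def zero_cx_def)
    show "\<forall>n. ideal_smult R I (cx_mod C n) = {\<zero>\<^bsub>cx_mod C n\<^esub>}"
    proof
      fix n
      interpret M: module R "cx_mod C n" by (rule mod)
      have z: "\<zero>\<^bsub>cx_mod C n\<^esub> \<in> ideal_smult R I (cx_mod C n)"
        by (rule M.submodule_zero[OF M.ideal_smult_submodule[OF IR]])
      have "x = y" if "x \<in> ideal_smult R I (cx_mod C n)" "y \<in> ideal_smult R I (cx_mod C n)" for x y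
        using inj_onD[OF bij_betw_imp_inj_on[OF f[of n]] _ that] by simp
      then show "ideal_smult R I (cx_mod C n) = {\<zero>\<^bsub>cx_mod C n\<^esub>}" using z by blast
    qed
  next
    assume "\<forall>n. ideal_smult R I (cx_mod C n) = {\<zero>\<^bsub>cx_mod C n\<^esub>}"
    then show "cx_iso R (ideal_cx R I C) zero_cx"
      unfolding cx_iso_def
      by (intro exI[of _ "\<lambda>_ _. ()"])
        (auto simp: ideal_cx_def zero_cx_def mod_hom_def bij_betw_def PiE_def extensional_def)
  qed
  then show ?thesis using module.ideal_smult_eq_zero_iff[OF mod IR] by simp
qed

theorem theorem1p2:
  fixes A :: "('a, 'r) ring_scheme" and \<aa> :: "'a set"
  assumes "cring A" and "ideal \<aa> A"
  shows "(cx_tor A \<aa> :: ('a, 'm) cochain set) \<inter> cx_red A \<aa> = cx_com A \<aa> \<inter> cx_cor A \<aa> \<and>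
         (cx_com A \<aa> :: ('a, 'm) cochain set) \<inter> cx_cor A \<aa>
           = {M \<in> complexes A. cx_iso A (ideal_cx A \<aa> M) zero_cx}"
proof -
  have mod: "module A (cx_mod C n)" if "C \<in> complexes A" for C :: "('a, 'm) cochain" and n
    using that by (simp add: complexes_def)
  let ?Z = "{C \<in> complexes A. \<forall>n. \<forall>r\<in>\<aa>. \<forall>x\<in>carrier (cx_mod C n).
    r \<odot>\<^bsub>cx_mod C n\<^esub> x = \<zero>\<^bsub>cx_mod C n\<^esub>} :: ('a, 'm) cochain set"
  have "cx_tor A \<aa> \<inter> cx_red A \<aa> = ?Z"
    unfolding cx_tor_def cx_red_def
    using module.torsion_and_reduced_iff[OF mod assms(2)] by blast
  moreover have "cx_com A \<aa> \<inter> cx_cor A \<aa> = ?Z"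
    unfolding cx_com_def cx_cor_def
    using module.complete_and_coreduced_iff[OF mod assms(2)] by blast
  moreover have "{C \<in> complexes A. cx_iso A (ideal_cx A \<aa> C) zero_cx} = ?Z"
    using cring.ideal_cx_iso_zero_iff[OF assms] by blast
  ultimately show ?thesis by simp
qed

end
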